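(* Let $(\mathcal{A}',\mathcal{A},\mathcal{A}'',i^*,i_*,i^!,j_!,j^*,j_* )$ be a recollement of abelian categories. There is a bijection between the set of ICE-closed subcategories $\mathcal{C}$ of $\mathcal{A}$ satisfying $i_*(\mathcal{A}')\subset\mathcal{C}$ and $j_!j^*(\mathcal{C})\subset\mathcal{C}$, and the set of all ICE-closed subcategories of $\mathcal{A}''$. It sends $\mathcal{C}$ to $j^*(\mathcal{C})$, and its inverse sends an ICE-closed subcategory $\mathcal{W}$ of $\mathcal{A}''$ to $\{M\in\mathcal{A}\mid j^*(M)\in\mathcal{W}\}$.
   Context: All subcategories are full and closed under isomorphisms; all functors between abelian categories are additive. For a functor $F$ and a subcategory $\mathcal{C}$ of its source, $F(\mathcal{C})$ denotes the essential image (objects isomorphic to $F(C)$ with $C\in\mathcal{C}$). A recollement $(\mathcal{A}',\mathcal{A},\mathcal{A}'',i^*,i_*,i^!,j_!,j^*,j_* )$ of abelian categories consists of abelian categories $\mathcal{A}',\mathcal{A},\mathcal{A}''$ and functors $i_*:\mathcal{A}'\to\mathcal{A}$, $i^*,i^!:\mathcal{A}\to\mathcal{A}'$, $j^*:\mathcal{A}\to\mathcal{A}''$, $j_!,j_*:\mathcal{A}''\to\mathcal{A}$ such that: (i) $(i^*,i_* )$, $(i_*,i^!)$, $(j_!,j^* )$, $(j^*,j_* )$ are adjoint pairs (left adjoint first); (ii) $i_*$, $j_!$, $j_*$ are fully faithful; (iii) the full subcategory $\mathrm{Ker}\,j^*$ of objects killed by $j^*$ equals the essential image of $i_*$. A subcategory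 $\mathcal{C}$ of an abelian category is ICE-closed if it is closed under images, cokernels and extensions: for every morphism $f:M\to N$ with $M,N\in\mathcal{C}$ one has $\mathrm{Im} f\in\mathcal{C}$ and $\mathrm{Coker} f\in\mathcal{C}$, and for every short exact sequence $0\to N_1\to N_2\to N_3\to 0$ with $N_1,N_3\in\mathcal{C}$ one has $N_2\in\mathcal{C}$. The empty subcategory, the zero subcategory and the entire category are all counted as ICE-closed subcategories.
   Formalization: The empty subcategory of A'' is excluded from the ICE-closed subcategories W: every C containing i_*(A') is nonempty, so j^*(C) is never empty, and the claim fails for W empty. *)

theory Defs
  imports "HOL-Algebra.Group"
begin

text \<open>
  A category is given by a carrier set of objects and a carrier set of arrows; nothing is assumed
  about values outside the carriers. The fields \<open>Add\<close> and \<open>Zer\<close> hold the abelian group structure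
  on the hom-sets.
\<close>

record ('o, 'm) acat =
  Obj :: "'o set"
  Arr :: "'m set"
  Dom :: "'m \<Rightarrow> 'o"
  Cod :: "'m \<Rightarrow> 'o"
  Idn :: "'o \<Rightarrow> 'm"
  Comp :: "'m \<Rightarrow> 'm \<Rightarrow> 'm"  (infixl \<open>\<cdot>\<index>\<close> 70)
  Add :: "'m \<Rightarrow> 'm \<Rightarrow> 'm"
  Zer :: "'o \<Rightarrow> 'o \<Rightarrow> 'm"

definition Hom :: "('o, 'm) acat \<Rightarrow> 'o \<Rightarrow> 'o \<Rightarrow> 'm set" where
  "Hom C X Y = {f \<in> Arr C. Dom C f = X \<and> Cod C f = Y}"

definition hom_group :: "('o, 'm) acat \<Rightarrow> 'o \<Rightarrow> 'o \<Rightarrow> 'm monoid" where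
  "hom_group C X Y = \<lparr>carrier = Hom C X Y, mult = Add C, one = Zer C X Y\<rparr>"

locale cat =
  fixes C :: "('o, 'm) acat" (structure)
  assumes Dom_Obj: "f \<in> Arr C \<Longrightarrow> Dom C f \<in> Obj C"
    and Cod_Obj: "f \<in> Arr C \<Longrightarrow> Cod C f \<in> Obj C"
    and Idn_Hom: "X \<in> Obj C \<Longrightarrow> Idn C X \<in> Hom C X X"
    and Comp_Hom: "\<lbrakk>f \<in> Hom C X Y; g \<in> Hom C Y Z\<rbrakk> \<Longrightarrow> g \<cdot> f \<in> Hom C X Z"
    and Idn_left: "f \<in> Hom C X Y \<Longrightarrow> Idn C Y \<cdot> f = f"
    and Idn_right: "f \<in> Hom C X Y \<Longrightarrow> f \<cdot> Idn C X = f"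
    and Comp_assoc: "\<lbrakk>f \<in> Hom C W X; g \<in> Hom C X Y; h \<in> Hom C Y Z\<rbrakk>
      \<Longrightarrow> (h \<cdot> g) \<cdot> f = h \<cdot> (g \<cdot> f)"

locale preadditive_cat = cat +
  assumes hom_comm_group: "\<lbrakk>X \<in> Obj C; Y \<in> Obj C\<rbrakk> \<Longrightarrow> comm_group (hom_group C X Y)"
    and Comp_Add_right: "\<lbrakk>f \<in> Hom C X Y; f' \<in> Hom C X Y; g \<in> Hom C Y Z\<rbrakk>
      \<Longrightarrow> g \<cdot> Add C f f' = Add C (g \<cdot> f) (g \<cdot> f')"
    and Comp_Add_left: "\<lbrakk>f \<in> Hom C X Y; g \<in> Hom C Y Z; g' \<in> Hom C Y Z\<rbrakk>
      \<Longrightarrow> Add C g g' \<cdot> f = Add C (g \<cdot> f) (g' \<cdot> f)"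

definition isomorphic :: "('o, 'm) acat \<Rightarrow> 'o \<Rightarrow> 'o \<Rightarrow> bool" where
  "isomorphic C X Y \<longleftrightarrow> (\<exists>f \<in> Hom C X Y. \<exists>g \<in> Hom C Y X.
     g \<cdot>\<^bsub>C\<^esub> f = Idn C X \<and> f \<cdot>\<^bsub>C\<^esub> g = Idn C Y)"

definition zero_obj :: "('o, 'm) acat \<Rightarrow> 'o \<Rightarrow> bool" where
  "zero_obj C Z \<longleftrightarrow> Z \<in> Obj C \<and>
     (\<forall>X \<in> Obj C. (\<exists>!f. f \<in> Hom C X Z) \<and> (\<exists>!f. f \<in> Hom C Z X))"

definition mono_arr :: "('o, 'm) acat \<Rightarrow> 'm \<Rightarrow> bool" where
  "mono_arr C f \<longleftrightarrow> f \<in> Arr C \<and>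
     (\<forall>X. \<forall>g \<in> Hom C X (Dom C f). \<forall>h \<in> Hom C X (Dom C f). f \<cdot>\<^bsub>C\<^esub> g = f \<cdot>\<^bsub>C\<^esub> h \<longrightarrow> g = h)"

definition epi_arr :: "('o, 'm) acat \<Rightarrow> 'm \<Rightarrow> bool" where
  "epi_arr C f \<longleftrightarrow> f \<in> Arr C \<and>
     (\<forall>X. \<forall>g \<in> Hom C (Cod C f) X. \<forall>h \<in> Hom C (Cod C f) X. g \<cdot>\<^bsub>C\<^esub> f = h \<cdot>\<^bsub>C\<^esub> f \<longrightarrow> g = h)"

definition is_kernel :: "('o, 'm) acat \<Rightarrow> 'm \<Rightarrow> 'm \<Rightarrow> bool" where
  "is_kernel C f k \<longleftrightarrow> f \<in> Arr C \<and> k \<in> Arr C \<and> Cod C k = Dom C f \<and>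
     f \<cdot>\<^bsub>C\<^esub> k = Zer C (Dom C k) (Cod C f) \<and>
     (\<forall>X. \<forall>h \<in> Hom C X (Dom C f). f \<cdot>\<^bsub>C\<^esub> h = Zer C X (Cod C f) \<longrightarrow>
        (\<exists>!u. u \<in> Hom C X (Dom C k) \<and> k \<cdot>\<^bsub>C\<^esub> u = h))"

definition is_cokernel :: "('o, 'm) acat \<Rightarrow> 'm \<Rightarrow> 'm \<Rightarrow> bool" where
  "is_cokernel C f c \<longleftrightarrow> f \<in> Arr C \<and> c \<in> Arr C \<and> Dom C c = Cod C f \<and>
     c \<cdot>\<^bsub>C\<^esub> f = Zer C (Dom C f) (Cod C c) \<and>
     (\<forall>X. \<forall>h \<in> Hom C (Cod C f) X. h \<cdot>\<^bsub>C\<^esub> f = Zer C (Dom C f) X \<longrightarrow>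
        (\<exists>!u. u \<in> Hom C (Cod C c) X \<and> u \<cdot>\<^bsub>C\<^esub> c = h))"

text \<open>The image of \<open>f\<close> is the kernel of its cokernel, as a subobject \<open>m\<close> of the codomain of \<open>f\<close>.\<close>

definition is_image :: "('o, 'm) acat \<Rightarrow> 'm \<Rightarrow> 'm \<Rightarrow> bool" where
  "is_image C f m \<longleftrightarrow> (\<exists>c. is_cokernel C f c \<and> is_kernel C c m)"

definition is_biproduct :: "('o, 'm) acat \<Rightarrow> 'o \<Rightarrow> 'o \<Rightarrow> 'o \<Rightarrow> bool" where
  "is_biproduct C X Y P \<longleftrightarrow> (\<exists>i1 \<in> Hom C X P. \<exists>i2 \<in> Hom C Y P. \<exists>p1 \<in> Hom C P X. \<exists>p2 \<in> Hom C P Y.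
     p1 \<cdot>\<^bsub>C\<^esub> i1 = Idn C X \<and> p2 \<cdot>\<^bsub>C\<^esub> i2 = Idn C Y \<and>
     p1 \<cdot>\<^bsub>C\<^esub> i2 = Zer C Y X \<and> p2 \<cdot>\<^bsub>C\<^esub> i1 = Zer C X Y \<and>
     Add C (i1 \<cdot>\<^bsub>C\<^esub> p1) (i2 \<cdot>\<^bsub>C\<^esub> p2) = Idn C P)"

locale abelian_cat = preadditive_cat +
  assumes ex_zero_obj: "\<exists>Z. zero_obj C Z"
    and ex_biproduct: "\<lbrakk>X \<in> Obj C; Y \<in> Obj C\<rbrakk> \<Longrightarrow> \<exists>P \<in> Obj C. is_biproduct C X Y P"
    and ex_kernel: "f \<in> Arr C \<Longrightarrow> \<exists>k. is_kernel C f k"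
    and ex_cokernel: "f \<in> Arr C \<Longrightarrow> \<exists>c. is_cokernel C f c"
    and mono_normal: "mono_arr C f \<Longrightarrow> \<exists>g. is_kernel C g f"
    and epi_normal: "epi_arr C f \<Longrightarrow> \<exists>g. is_cokernel C g f"

text \<open>In the exactness condition, \<open>Im f = Ker g\<close> is an equality of subobjects.\<close>

definition short_exact :: "('o, 'm) acat \<Rightarrow> 'm \<Rightarrow> 'm \<Rightarrow> bool" where
  "short_exact C f g \<longleftrightarrow> mono_arr C f \<and> epi_arr C g \<and> (\<exists>m. is_image C f m \<and> is_kernel C g m)"

text \<open>
  A full subcategory is identified with its set of objects. Images and cokernels are only
  determined up to isomorphism, so the closure conditions range over all choices of them.
  The empty set satisfies \<open>ICE_closed\<close>; a subcategory containing the essential image of \<open>i\<^sub>*\<close>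
  is never empty, so the empty subcategory of \<open>A''\<close> has to be left out of any bijection with these.
\<close>

definition subcategory :: "('o, 'm) acat \<Rightarrow> 'o set \<Rightarrow> bool" where
  "subcategory C S \<longleftrightarrow> S \<subseteq> Obj C \<and> (\<forall>X \<in> S. \<forall>Y \<in> Obj C. isomorphic C X Y \<longrightarrow> Y \<in> S)"

definition ICE_closed :: "('o, 'm) acat \<Rightarrow> 'o set \<Rightarrow> bool" where
  "ICE_closed C S \<longleftrightarrow> subcategory C S \<and>
     (\<forall>M \<in> S. \<forall>N \<in> S. \<forall>f \<in> Hom C M N.
        (\<forall>m. is_image C f m \<longrightarrow> Dom C m \<in> S) \<and> (\<forall>c. is_cokernel C f c \<longrightarrow> Cod C c \<in> S)) \<and>
     (\<forall>N1 N2 N3 f g. f \<in> Hom C N1 N2 \<longrightarrow> g \<in> Hom C N2 N3 \<longrightarrow> short_exact C f g \<longrightarrow>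
        N1 \<in> S \<longrightarrow> N3 \<in> S \<longrightarrow> N2 \<in> S)"

record ('o1, 'm1, 'o2, 'm2) ftr =
  ob :: "'o1 \<Rightarrow> 'o2"
  ar :: "'m1 \<Rightarrow> 'm2"

definition ftr_comp ::
  "('o2, 'm2, 'o3, 'm3) ftr \<Rightarrow> ('o1, 'm1, 'o2, 'm2) ftr \<Rightarrow> ('o1, 'm1, 'o3, 'm3) ftr" where
  "ftr_comp G F = \<lparr>ob = ob G \<circ> ob F, ar = ar G \<circ> ar F\<rparr>"

locale additive_functor =
  C: preadditive_cat C + D: preadditive_cat D
  for C :: "('o1, 'm1) acat" and D :: "('o2, 'm2) acat" and F :: "('o1, 'm1, 'o2, 'm2) ftr" +
  assumes ob_Obj: "X \<in> Obj C \<Longrightarrow> ob F X \<in> Obj D"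
    and ar_Hom: "f \<in> Hom C X Y \<Longrightarrow> ar F f \<in> Hom D (ob F X) (ob F Y)"
    and ar_Idn: "X \<in> Obj C \<Longrightarrow> ar F (Idn C X) = Idn D (ob F X)"
    and ar_Comp: "\<lbrakk>f \<in> Hom C X Y; g \<in> Hom C Y Z\<rbrakk> \<Longrightarrow> ar F (g \<cdot>\<^bsub>C\<^esub> f) = ar F g \<cdot>\<^bsub>D\<^esub> ar F f"
    and ar_Add: "\<lbrakk>X \<in> Obj C; Y \<in> Obj C\<rbrakk>
      \<Longrightarrow> ar F \<in> hom (hom_group C X Y) (hom_group D (ob F X) (ob F Y))"

definition fully_faithful ::
  "('o1, 'm1) acat \<Rightarrow> ('o2, 'm2) acat \<Rightarrow> ('o1, 'm1, 'o2, 'm2) ftr \<Rightarrow> bool" where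
  "fully_faithful C D F \<longleftrightarrow>
     (\<forall>X \<in> Obj C. \<forall>Y \<in> Obj C. bij_betw (ar F) (Hom C X Y) (Hom D (ob F X) (ob F Y)))"

text \<open>\<open>F : C \<rightarrow> D\<close> is left adjoint to \<open>G : D \<rightarrow> C\<close>, via a bijection
  \<open>\<phi> X Y : D(F X, Y) \<rightarrow> C(X, G Y)\<close> natural in both variables.\<close>

definition adjoint_pair :: "('o1, 'm1) acat \<Rightarrow> ('o2, 'm2) acat \<Rightarrow>
    ('o1, 'm1, 'o2, 'm2) ftr \<Rightarrow> ('o2, 'm2, 'o1, 'm1) ftr \<Rightarrow> bool" where
  "adjoint_pair C D F G \<longleftrightarrow> (\<exists>\<phi>.
     (\<forall>X \<in> Obj C. \<forall>Y \<in> Obj D. bij_betw (\<phi> X Y) (Hom D (ob F X) Y) (Hom C X (ob G Y))) \<and>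
     (\<forall>X \<in> Obj C. \<forall>X' \<in> Obj C. \<forall>Y \<in> Obj D. \<forall>Y' \<in> Obj D.
        \<forall>a \<in> Hom C X' X. \<forall>b \<in> Hom D Y Y'. \<forall>f \<in> Hom D (ob F X) Y.
          \<phi> X' Y' (b \<cdot>\<^bsub>D\<^esub> f \<cdot>\<^bsub>D\<^esub> ar F a) = ar G b \<cdot>\<^bsub>C\<^esub> \<phi> X Y f \<cdot>\<^bsub>C\<^esub> a))"

definition ess_image ::
  "('o2, 'm2) acat \<Rightarrow> ('o1, 'm1, 'o2, 'm2) ftr \<Rightarrow> 'o1 set \<Rightarrow> 'o2 set" where
  "ess_image D F S = {Y \<in> Obj D. \<exists>X \<in> S. isomorphic D (ob F X) Y}"

text \<open>
  The functors are named by the position and shape of their decoration: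
  \<open>i_us\<close>, \<open>i_ls\<close>, \<open>i_ush\<close> are the functors i-upper-star, i-lower-star, i-upper-shriek, and
  \<open>j_lsh\<close>, \<open>j_us\<close>, \<open>j_ls\<close> are j-lower-shriek, j-upper-star, j-lower-star.
\<close>

locale recollement =
  A': abelian_cat A' + A: abelian_cat A + A'': abelian_cat A'' +
  i_us: additive_functor A A' i_us + i_ls: additive_functor A' A i_ls +
  i_ush: additive_functor A A' i_ush +
  j_lsh: additive_functor A'' A j_lsh + j_us: additive_functor A A'' j_us +
  j_ls: additive_functor A'' A j_ls
  for A' :: "('o1, 'm1) acat" and A :: "('o2, 'm2) acat" and A'' :: "('o3, 'm3) acat"
    and i_us :: "('o2, 'm2, 'o1, 'm1) ftr" and i_ls :: "('o1, 'm1, 'o2, 'm2) ftr"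
    and i_ush :: "('o2, 'm2, 'o1, 'm1) ftr"
    and j_lsh :: "('o3, 'm3, 'o2, 'm2) ftr" and j_us :: "('o2, 'm2, 'o3, 'm3) ftr"
    and j_ls :: "('o3, 'm3, 'o2, 'm2) ftr" +
  assumes adj_i_us_i_ls: "adjoint_pair A A' i_us i_ls"
    and adj_i_ls_i_ush: "adjoint_pair A' A i_ls i_ush"
    and adj_j_lsh_j_us: "adjoint_pair A'' A j_lsh j_us"
    and adj_j_us_j_ls: "adjoint_pair A A'' j_us j_ls"
    and ff_i_ls: "fully_faithful A' A i_ls"
    and ff_j_lsh: "fully_faithful A'' A j_lsh"
    and ff_j_ls: "fully_faithful A'' A j_ls"
    and ker_j_us: "{M \<in> Obj A. zero_obj A'' (ob j_us M)} = ess_image A i_ls (Obj A')"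

end

theory Submission
  imports Defs
begin

text \<open>
  Since \<open>j\<^sup>*\<close> has both adjoints, it preserves kernels and cokernels, and since \<open>j\<^sub>!\<close> is
  fully faithful, the unit \<open>X \<rightarrow> j\<^sup>* j\<^sub>! X\<close> is invertible. Hence \<open>j\<^sup>*\<close> inverts the counit
  \<open>j\<^sub>! j\<^sup>* M \<rightarrow> M\<close>, whose kernel and cokernel therefore lie in \<open>Ker j\<^sup>*\<close>, the essential
  image of \<open>i\<^sub>*\<close>. An ICE-closed subcategory containing the source, the kernel and the cokernel of
  an arrow also contains its target, because the target is an extension of the cokernel by the
  coimage. Applied to the counit this shows that \<open>\<C>\<close> is the preimage of \<open>j\<^sup>*(\<C>)\<close>; applied
  to \<open>j\<^sub>! f\<close> for a monomorphism \<open>f\<close> it shows that \<open>j\<^sup>*(\<C>)\<close> is closed under extensions.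
\<close>

section \<open>Preadditive and abelian categories\<close>

lemma HomD:
  assumes "f \<in> Hom C X Y"
  shows "f \<in> Arr C" "Dom C f = X" "Cod C f = Y"
  using assms by (auto simp: Hom_def)

lemma Arr_Hom: "f \<in> Arr C \<Longrightarrow> f \<in> Hom C (Dom C f) (Cod C f)"
  by (simp add: Hom_def)

lemma isomorphicI:
  assumes "f \<in> Hom C X Y" "g \<in> Hom C Y X" "g \<cdot>\<^bsub>C\<^esub> f = Idn C X" "f \<cdot>\<^bsub>C\<^esub> g = Idn C Y"
  shows "isomorphic C X Y"
  using assms by (auto simp: isomorphic_def)

lemma isomorphic_sym: "isomorphic C X Y \<Longrightarrow> isomorphic C Y X"
  by (auto simp: isomorphic_def)

section \<open>Isomorphism-closed subcategories and cancellable arrows in a plain category\<close>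

context cat
begin

lemma Hom_Obj:
  assumes "f \<in> Hom C X Y"
  shows "X \<in> Obj C" "Y \<in> Obj C"
  using assms Dom_Obj Cod_Obj by (auto simp: Hom_def)

lemma isomorphic_refl: "X \<in> Obj C \<Longrightarrow> isomorphic C X X"
  using Idn_Hom Idn_left by (blast intro: isomorphicI)

lemma subcategory_isomorphic_iff:
  assumes "subcategory C S" "isomorphic C X Y"
  shows "X \<in> S \<longleftrightarrow> Y \<in> S"
proof -
  have "X \<in> Obj C" "Y \<in> Obj C"
    using assms(2) Hom_Obj unfolding isomorphic_def by blast+
  then show ?thesis
    using assms isomorphic_sym[OF assms(2)] unfolding subcategory_def by blast
qed

text \<open>Precomposing with the right inverse \<open>s\<close> recovers \<open>g\<close> from
  \<open>g \<cdot> f\<close>.\<close>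

lemma section_epi_arr:
  assumes "f \<in> Hom C X Y" "s \<in> Hom C Y X" "f \<cdot> s = Idn C Y"
  shows "epi_arr C f"
proof -
  have "g = (g \<cdot> f) \<cdot> s" if "g \<in> Hom C Y T" for g T
    by (metis Comp_assoc Idn_right assms that)
  then show ?thesis
    unfolding epi_arr_def HomD[OF assms(1)] using HomD(1)[OF assms(1)] by metis
qed

lemma retraction_mono_arr:
  assumes "f \<in> Hom C X Y" "s \<in> Hom C Y X" "s \<cdot> f = Idn C X"
  shows "mono_arr C f"
proof -
  have "g = s \<cdot> (f \<cdot> g)" if "g \<in> Hom C T X" for g T
    by (metis Comp_assoc Idn_left assms that)
  then show ?thesis
    unfolding mono_arr_def HomD[OF assms(1)] using HomD(1)[OF assms(1)] by metis
qed

lemma epi_arr_comp: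
  assumes "f \<in> Hom C X Y" "g \<in> Hom C Y Z" "epi_arr C f" "epi_arr C g"
  shows "epi_arr C (g \<cdot> f)"
  unfolding epi_arr_def
proof (intro conjI allI ballI impI)
  have gf: "g \<cdot> f \<in> Hom C X Z"
    using assms(1,2) by (rule Comp_Hom)
  then show "g \<cdot> f \<in> Arr C"
    by (rule HomD)
  fix T u v
  assume "u \<in> Hom C (Cod C (g \<cdot> f)) T" "v \<in> Hom C (Cod C (g \<cdot> f)) T"
    and eq: "u \<cdot> (g \<cdot> f) = v \<cdot> (g \<cdot> f)"
  then have u: "u \<in> Hom C Z T" and v: "v \<in> Hom C Z T"
    by (simp_all add: HomD[OF gf])
  have "(u \<cdot> g) \<cdot> f = (v \<cdot> g) \<cdot> f"
    using eq by (simp add: Comp_assoc[OF assms(1,2) u] Comp_assoc[OF assms(1,2) v])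
  then have "u \<cdot> g = v \<cdot> g"
    using assms(3) Comp_Hom[OF assms(2) u] Comp_Hom[OF assms(2) v]
    by (auto simp: epi_arr_def HomD[OF assms(1)])
  then show "u = v"
    using assms(4) u v by (auto simp: epi_arr_def HomD[OF assms(2)])
qed

end

section \<open>Zero arrows, kernels, cokernels and zero objects in a preadditive category\<close>

context preadditive_cat
begin

lemma Zer_Hom:
  assumes "X \<in> Obj C" "Y \<in> Obj C"
  shows "Zer C X Y \<in> Hom C X Y"
proof -
  interpret G: comm_group "hom_group C X Y"
    using assms by (rule hom_comm_group)
  show ?thesis
    using G.one_closed by (simp add: hom_group_def)
qed

text \<open>The neutral element is the only idempotent of a group. Bilinearity makes a composite
  with a zero arrow idempotent under \<open>Add\<close>, and this is how such composites are
  recognised as zero below.\<close>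

lemma Add_idem_Zer:
  assumes "f \<in> Hom C X Y" "Add C f f = f"
  shows "f = Zer C X Y"
proof -
  interpret G: comm_group "hom_group C X Y"
    using Hom_Obj[OF assms(1)] by (rule hom_comm_group)
  show ?thesis
    using G.l_cancel_one[of f f] assms by (simp add: hom_group_def)
qed

lemma Add_Zer_Zer:
  assumes "X \<in> Obj C" "Y \<in> Obj C"
  shows "Add C (Zer C X Y) (Zer C X Y) = Zer C X Y"
proof -
  interpret G: comm_group "hom_group C X Y"
    using assms by (rule hom_comm_group)
  show ?thesis
    using G.l_one[OF G.one_closed] by (simp add: hom_group_def)
qed

lemma Comp_Zer:
  assumes "g \<in> Hom C Y Z" "X \<in> Obj C"
  shows "g \<cdot> Zer C X Y = Zer C X Z"
proof -
  have z: "Zer C X Y \<in> Hom C X Y"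
    using assms Hom_Obj by (blast intro: Zer_Hom)
  show ?thesis
    using Comp_Add_right[OF z z assms(1)] Add_Zer_Zer[OF Hom_Obj[OF z]] Comp_Hom[OF z assms(1)]
    by (auto intro: Add_idem_Zer)
qed

lemma Zer_Comp:
  assumes "f \<in> Hom C X Y" "Z \<in> Obj C"
  shows "Zer C Y Z \<cdot> f = Zer C X Z"
proof -
  have z: "Zer C Y Z \<in> Hom C Y Z"
    using assms Hom_Obj by (blast intro: Zer_Hom)
  show ?thesis
    using Comp_Add_left[OF assms(1) z z] Add_Zer_Zer[OF Hom_Obj[OF z]] Comp_Hom[OF assms(1) z]
    by (auto intro: Add_idem_Zer)
qed

text \<open>If \<open>f\<close> equalises \<open>g\<close> and \<open>h\<close>, it kills their
  difference, formed below as \<open>Add C g ?n\<close> with \<open>?n\<close> the negative of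
  \<open>h\<close>.\<close>

lemma mono_arrI_Zer:
  assumes f: "f \<in> Hom C X Y"
    and ker: "\<And>T g. g \<in> Hom C T X \<Longrightarrow> f \<cdot> g = Zer C T Y \<Longrightarrow> g = Zer C T X"
  shows "mono_arr C f"
  unfolding mono_arr_def
proof (intro conjI allI ballI impI)
  show "f \<in> Arr C"
    using f by (rule HomD)
  fix T g h
  assume "g \<in> Hom C T (Dom C f)" "h \<in> Hom C T (Dom C f)" and eq: "f \<cdot> g = f \<cdot> h"
  then have g: "g \<in> Hom C T X" and h: "h \<in> Hom C T X"
    by (simp_all add: HomD[OF f])
  interpret G: comm_group "hom_group C T X"
    using Hom_Obj[OF g] by (rule hom_comm_group)
  let ?n = "inv\<^bsub>hom_group C T X\<^esub> h"
  have n: "?n \<in> Hom C T X"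
    using G.inv_closed[of h] h by (simp add: hom_group_def)
  have "f \<cdot> Add C g ?n = f \<cdot> Add C h ?n"
    by (simp add: Comp_Add_right[OF _ n f] g h eq)
  also have "Add C h ?n = Zer C T X"
    using G.r_inv[of h] h by (simp add: hom_group_def)
  also have "f \<cdot> Zer C T X = Zer C T Y"
    using f Hom_Obj[OF g] by (simp add: Comp_Zer)
  finally have "Add C g ?n = Zer C T X"
    using G.m_closed[of g ?n] g n by (intro ker) (simp_all add: hom_group_def)
  then have "g \<otimes>\<^bsub>hom_group C T X\<^esub> ?n = h \<otimes>\<^bsub>hom_group C T X\<^esub> ?n"
    using G.r_inv[of h] h by (simp add: hom_group_def)
  then show "g = h"
    using G.right_cancel[of ?n g h] g h n by (simp add: hom_group_def)
qed

text \<open>Stated for an arrow with named ends \<open>X\<close> and \<open>Y\<close>, and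
  extracting only the existence of factorisations; their uniqueness is carried by
  \<open>is_kernel_mono\<close>.\<close>

lemma is_kernelD:
  assumes "is_kernel C f k" "f \<in> Hom C X Y"
  shows "k \<in> Hom C (Dom C k) X" "f \<cdot> k = Zer C (Dom C k) Y"
    and "\<And>T h. h \<in> Hom C T X \<Longrightarrow> f \<cdot> h = Zer C T Y \<Longrightarrow> \<exists>u \<in> Hom C T (Dom C k). k \<cdot> u = h"
proof -
  note f = HomD[OF assms(2)] and k = assms(1)[unfolded is_kernel_def]
  show "k \<in> Hom C (Dom C k) X" "f \<cdot> k = Zer C (Dom C k) Y"
    using k by (simp_all add: Hom_def f)
  show "\<exists>u \<in> Hom C T (Dom C k). k \<cdot> u = h" if "h \<in> Hom C T X" "f \<cdot> h = Zer C T Y" for T h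
    using k that unfolding f by blast
qed

lemma is_cokernelD:
  assumes "is_cokernel C f c" "f \<in> Hom C X Y"
  shows "c \<in> Hom C Y (Cod C c)" "c \<cdot> f = Zer C X (Cod C c)"
    and "\<And>T h. h \<in> Hom C Y T \<Longrightarrow> h \<cdot> f = Zer C X T \<Longrightarrow> \<exists>u \<in> Hom C (Cod C c) T. u \<cdot> c = h"
proof -
  note f = HomD[OF assms(2)] and c = assms(1)[unfolded is_cokernel_def]
  show "c \<in> Hom C Y (Cod C c)" "c \<cdot> f = Zer C X (Cod C c)"
    using c by (simp_all add: Hom_def f)
  show "\<exists>u \<in> Hom C (Cod C c) T. u \<cdot> c = h" if "h \<in> Hom C Y T" "h \<cdot> f = Zer C X T" for T h
    using c that unfolding f by blast
qed

text \<open>If \<open>k \<cdot> u = k \<cdot> v\<close>, both \<open>u\<close> and \<open>v\<close>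
  factor this one arrow, which \<open>f\<close> kills, through \<open>k\<close>; the universal
  property allows only one factorisation.\<close>

lemma is_kernel_mono:
  assumes "is_kernel C f k"
  shows "mono_arr C k"
proof -
  let ?X = "Dom C f" and ?Y = "Cod C f"
  have f: "f \<in> Hom C ?X ?Y"
    using assms by (simp add: is_kernel_def Arr_Hom)
  note k = is_kernelD[OF assms f]
  have kh: "k \<cdot> h \<in> Hom C T ?X" "f \<cdot> (k \<cdot> h) = Zer C T ?Y" if "h \<in> Hom C T (Dom C k)" for h T
    using Comp_Hom[OF that k(1)] Comp_assoc[OF that k(1) f] Zer_Comp[OF that Hom_Obj(2)[OF f]] k(2)
    by auto
  show ?thesis
    unfolding mono_arr_def
  proof (intro conjI allI ballI impI)
    show "k \<in> Arr C"
      using k(1) by (rule HomD)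
    fix T u v
    assume "u \<in> Hom C T (Dom C k)" "v \<in> Hom C T (Dom C k)" "k \<cdot> u = k \<cdot> v"
    moreover have "\<exists>!w. w \<in> Hom C T (Dom C k) \<and> k \<cdot> w = k \<cdot> v"
      using assms kh[OF \<open>v \<in> _\<close>] by (simp add: is_kernel_def)
    ultimately show "u = v"
      by blast
  qed
qed

lemma is_cokernel_epi:
  assumes "is_cokernel C f c"
  shows "epi_arr C c"
proof -
  let ?X = "Dom C f" and ?Y = "Cod C f"
  have f: "f \<in> Hom C ?X ?Y"
    using assms by (simp add: is_cokernel_def Arr_Hom)
  note c = is_cokernelD[OF assms f]
  have hc: "h \<cdot> c \<in> Hom C ?Y T" "(h \<cdot> c) \<cdot> f = Zer C ?X T" if "h \<in> Hom C (Cod C c) T" for h T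
    using Comp_Hom[OF c(1) that] Comp_assoc[OF f c(1) that] Comp_Zer[OF that Hom_Obj(1)[OF f]] c(2)
    by auto
  show ?thesis
    unfolding epi_arr_def
  proof (intro conjI allI ballI impI)
    show "c \<in> Arr C"
      using c(1) by (rule HomD)
    fix T u v
    assume "u \<in> Hom C (Cod C c) T" "v \<in> Hom C (Cod C c) T" "u \<cdot> c = v \<cdot> c"
    moreover have "\<exists>!w. w \<in> Hom C (Cod C c) T \<and> w \<cdot> c = v \<cdot> c"
      using assms hc[OF \<open>v \<in> _\<close>] by (simp add: is_cokernel_def)
    ultimately show "u = v"
      by blast
  qed
qed

lemma mono_arr_cancel:
  assumes "mono_arr C f" "f \<in> Hom C X Y" "g \<in> Hom C T X" "h \<in> Hom C T X" "f \<cdot> g = f \<cdot> h"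
  shows "g = h"
  using assms HomD[OF assms(2)] by (auto simp: mono_arr_def)

lemma epi_arr_cancel:
  assumes "epi_arr C f" "f \<in> Hom C X Y" "g \<in> Hom C Y T" "h \<in> Hom C Y T" "g \<cdot> f = h \<cdot> f"
  shows "g = h"
  using assms HomD[OF assms(2)] by (auto simp: epi_arr_def)

lemma is_kernelI:
  assumes f: "f \<in> Hom C X Y" and k: "k \<in> Hom C K X" "f \<cdot> k = Zer C K Y" "mono_arr C k"
    and ex: "\<And>T h. h \<in> Hom C T X \<Longrightarrow> f \<cdot> h = Zer C T Y \<Longrightarrow> \<exists>u \<in> Hom C T K. k \<cdot> u = h"
  shows "is_kernel C f k"
proof -
  have "\<exists>!u. u \<in> Hom C T K \<and> k \<cdot> u = h" if "h \<in> Hom C T X" "f \<cdot> h = Zer C T Y" for T h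
    using ex[OF that] mono_arr_cancel[OF k(3,1)] by blast
  then show ?thesis
    using HomD[OF f] HomD[OF k(1)] k(2) by (simp add: is_kernel_def)
qed

lemma is_cokernelI:
  assumes f: "f \<in> Hom C X Y" and c: "c \<in> Hom C Y Z" "c \<cdot> f = Zer C X Z" "epi_arr C c"
    and ex: "\<And>T h. h \<in> Hom C Y T \<Longrightarrow> h \<cdot> f = Zer C X T \<Longrightarrow> \<exists>u \<in> Hom C Z T. u \<cdot> c = h"
  shows "is_cokernel C f c"
proof -
  have "\<exists>!u. u \<in> Hom C Z T \<and> u \<cdot> c = h" if "h \<in> Hom C Y T" "h \<cdot> f = Zer C X T" for T h
    using ex[OF that] epi_arr_cancel[OF c(3,1)] by blast
  then show ?thesis
    using HomD[OF f] HomD[OF c(1)] c(2) by (simp add: is_cokernel_def)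
qed

text \<open>Every arrow into or out of \<open>X\<close> is its own composite with the identity of
  \<open>X\<close>, hence zero.\<close>

lemma zero_objI:
  assumes "X \<in> Obj C" "Idn C X = Zer C X X"
  shows "zero_obj C X"
proof -
  have "f = Zer C T X" if "f \<in> Hom C T X" for f T
    using Idn_left[OF that] Zer_Comp[OF that assms(1)] assms(2) by simp
  moreover have "f = Zer C X T" if "f \<in> Hom C X T" for f T
    using Idn_right[OF that] Comp_Zer[OF that assms(1)] assms(2) by simp
  ultimately show ?thesis
    using assms(1) Zer_Hom by (metis zero_obj_def)
qed

lemma zero_obj_isomorphic:
  assumes "zero_obj C X" "zero_obj C Y"
  shows "isomorphic C X Y"
proof -
  have X: "X \<in> Obj C" and Y: "Y \<in> Obj C"
    using assms by (auto simp: zero_obj_def)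
  have "f = g" if "zero_obj C Z" "f \<in> Hom C Z Z" "g \<in> Hom C Z Z" for f g Z
    using that unfolding zero_obj_def by blast
  then show ?thesis
    using assms Zer_Hom[OF X Y] Zer_Hom[OF Y X] Idn_Hom[OF X] Idn_Hom[OF Y]
    by (intro isomorphicI) (blast intro: Comp_Hom)+
qed

text \<open>Cancelling \<open>f\<close> gives \<open>k = 0\<close>; then the identity and the zero
  endomorphism of the kernel object agree after composition with the mono \<open>k\<close>, so they
  are equal.\<close>

lemma kernel_of_mono_zero_obj:
  assumes "is_kernel C f k" "mono_arr C f"
  shows "zero_obj C (Dom C k)"
proof -
  have f: "f \<in> Hom C (Dom C f) (Cod C f)"
    using assms by (simp add: is_kernel_def Arr_Hom)
  note k = is_kernelD[OF assms(1) f]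
  have K: "Dom C k \<in> Obj C" and X: "Dom C f \<in> Obj C"
    using Hom_Obj[OF k(1)] by auto
  have "k = Zer C (Dom C k) (Dom C f)"
    using assms(2) f k(1) Zer_Hom[OF K X]
    by (rule mono_arr_cancel) (simp add: k(2) Comp_Zer[OF f K])
  then have "k \<cdot> Idn C (Dom C k) = k \<cdot> Zer C (Dom C k) (Dom C k)"
    using Idn_right[OF k(1)] Comp_Zer[OF k(1) K] by simp
  then have "Idn C (Dom C k) = Zer C (Dom C k) (Dom C k)"
    by (rule mono_arr_cancel[OF is_kernel_mono[OF assms(1)] k(1) Idn_Hom[OF K] Zer_Hom[OF K K]])
  then show ?thesis
    by (rule zero_objI[OF K])
qed

lemma cokernel_of_epi_zero_obj:
  assumes "is_cokernel C f c" "epi_arr C f"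
  shows "zero_obj C (Cod C c)"
proof -
  have f: "f \<in> Hom C (Dom C f) (Cod C f)"
    using assms by (simp add: is_cokernel_def Arr_Hom)
  note c = is_cokernelD[OF assms(1) f]
  have Z: "Cod C c \<in> Obj C" and Y: "Cod C f \<in> Obj C"
    using Hom_Obj[OF c(1)] by auto
  have "c = Zer C (Cod C f) (Cod C c)"
    using assms(2) f c(1) Zer_Hom[OF Y Z]
    by (rule epi_arr_cancel) (simp add: c(2) Zer_Comp[OF f Z])
  then have "Idn C (Cod C c) \<cdot> c = Zer C (Cod C c) (Cod C c) \<cdot> c"
    using Idn_left[OF c(1)] Zer_Comp[OF c(1) Z] by simp
  then have "Idn C (Cod C c) = Zer C (Cod C c) (Cod C c)"
    by (rule epi_arr_cancel[OF is_cokernel_epi[OF assms(1)] c(1) Idn_Hom[OF Z] Zer_Hom[OF Z Z]])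
  then show ?thesis
    by (rule zero_objI[OF Z])
qed

text \<open>A commutative square with invertible sides \<open>a\<close>, \<open>b\<close> induces
  arrows between the kernels in both directions. It serves to compare an arrow with its image under
  \<open>j_us\<close> after \<open>j_lsh\<close>, the sides being units.\<close>

lemma kernels_isomorphic:
  assumes f: "f \<in> Hom C X Y" "is_kernel C f k" and f': "f' \<in> Hom C X' Y'" "is_kernel C f' k'"
    and a: "a \<in> Hom C X X'" "a' \<in> Hom C X' X" "a' \<cdot> a = Idn C X" "a \<cdot> a' = Idn C X'"
    and b: "b \<in> Hom C Y Y'" "b' \<in> Hom C Y' Y" "b' \<cdot> b = Idn C Y" "b \<cdot> b' = Idn C Y'"
    and sq: "b \<cdot> f = f' \<cdot> a"
  shows "isomorphic C (Dom C k) (Dom C k')"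
proof -
  note k = is_kernelD[OF f(2,1)] and k' = is_kernelD[OF f'(2,1)]
  \<comment> \<open>The square formed by the inverses commutes as well; it yields the arrow
    \<open>v\<close> back from the second kernel.\<close>
  have sq': "b' \<cdot> f' = f \<cdot> a'"
  proof -
    have "b' \<cdot> f' = b' \<cdot> ((f' \<cdot> a) \<cdot> a')"
      using Comp_assoc[OF a(2,1) f'(1)] a(4) Idn_right[OF f'(1)] by simp
    also have "\<dots> = (b' \<cdot> (b \<cdot> f)) \<cdot> a'"
      using Comp_assoc[OF a(2) Comp_Hom[OF f(1) b(1)] b(2)] sq by simp
    also have "b' \<cdot> (b \<cdot> f) = f"
      using Comp_assoc[OF f(1) b(1,2)] b(3) Idn_left[OF f(1)] by simp
    finally show ?thesis .
  qed
  have "f' \<cdot> (a \<cdot> k) = Zer C (Dom C k) Y'"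
    using Comp_assoc[OF k(1) a(1) f'(1)] Comp_assoc[OF k(1) f(1) b(1)] sq k(2)
      Comp_Zer[OF b(1) Hom_Obj(1)[OF k(1)]] by simp
  then obtain u where u: "u \<in> Hom C (Dom C k) (Dom C k')" "k' \<cdot> u = a \<cdot> k"
    using k'(3)[OF Comp_Hom[OF k(1) a(1)]] by blast
  have "f \<cdot> (a' \<cdot> k') = Zer C (Dom C k') Y"
    using Comp_assoc[OF k'(1) a(2) f(1)] Comp_assoc[OF k'(1) f'(1) b(2)] sq' k'(2)
      Comp_Zer[OF b(2) Hom_Obj(1)[OF k'(1)]] by simp
  then obtain v where v: "v \<in> Hom C (Dom C k') (Dom C k)" "k \<cdot> v = a' \<cdot> k'"
    using k(3)[OF Comp_Hom[OF k'(1) a(2)]] by blast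
  have "k \<cdot> (v \<cdot> u) = k \<cdot> Idn C (Dom C k)"
    using Comp_assoc[OF u(1) v(1) k(1)] Comp_assoc[OF u(1) k'(1) a(2)]
      Comp_assoc[OF k(1) a(1,2)] u v a Idn_left[OF k(1)] Idn_right[OF k(1)] by simp
  then have vu: "v \<cdot> u = Idn C (Dom C k)"
    by (rule mono_arr_cancel[OF is_kernel_mono[OF f(2)] k(1) Comp_Hom[OF u(1) v(1)]
          Idn_Hom[OF Hom_Obj(1)[OF k(1)]]])
  have "k' \<cdot> (u \<cdot> v) = k' \<cdot> Idn C (Dom C k')"
    using Comp_assoc[OF v(1) u(1) k'(1)] Comp_assoc[OF v(1) k(1) a(1)]
      Comp_assoc[OF k'(1) a(2,1)] u v a Idn_left[OF k'(1)] Idn_right[OF k'(1)] by simp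
  then have uv: "u \<cdot> v = Idn C (Dom C k')"
    by (rule mono_arr_cancel[OF is_kernel_mono[OF f'(2)] k'(1) Comp_Hom[OF v(1) u(1)]
          Idn_Hom[OF Hom_Obj(1)[OF k'(1)]]])
  show ?thesis
    using u(1) v(1) vu uv by (rule isomorphicI)
qed

text \<open>If \<open>f'\<close> kills \<open>g\<close>, then \<open>b \<cdot> f\<close> kills
  \<open>a' \<cdot> g\<close>. Cancelling the monos \<open>b\<close> and \<open>f\<close> gives
  \<open>a' \<cdot> g = 0\<close>, and applying \<open>a\<close> recovers
  \<open>g = 0\<close>.\<close>

lemma mono_arr_conjugate:
  assumes f: "f \<in> Hom C X Y" "mono_arr C f" and f': "f' \<in> Hom C X' Y'"
    and a: "a \<in> Hom C X X'" "a' \<in> Hom C X' X" "a \<cdot> a' = Idn C X'"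
    and b: "b \<in> Hom C Y Y'" "mono_arr C b"
    and sq: "b \<cdot> f = f' \<cdot> a"
  shows "mono_arr C f'"
proof (rule mono_arrI_Zer[OF f'])
  fix T g
  assume g: "g \<in> Hom C T X'" and 0: "f' \<cdot> g = Zer C T Y'"
  have T: "T \<in> Obj C"
    using g by (rule Hom_Obj)
  have a'g: "a' \<cdot> g \<in> Hom C T X" and fa'g: "f \<cdot> (a' \<cdot> g) \<in> Hom C T Y"
    using g a(2) f(1) by (blast intro: Comp_Hom)+
  have aa'g: "a \<cdot> (a' \<cdot> g) = g"
    using Comp_assoc[OF g a(2,1)] a(3) Idn_left[OF g] by simp
  have "b \<cdot> (f \<cdot> (a' \<cdot> g)) = b \<cdot> Zer C T Y"
    using Comp_assoc[OF a'g f(1) b(1)] Comp_assoc[OF a'g a(1) f'] sq aa'g 0 Comp_Zer[OF b(1) T]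
    by simp
  then have "f \<cdot> (a' \<cdot> g) = f \<cdot> Zer C T X"
    using mono_arr_cancel[OF b(2,1) fa'g Zer_Hom[OF T Hom_Obj(2)[OF f(1)]]]
      Comp_Zer[OF f(1) T] by simp
  then have "a' \<cdot> g = Zer C T X"
    by (rule mono_arr_cancel[OF f(2,1) a'g Zer_Hom[OF T Hom_Obj(1)[OF f(1)]]])
  then show "g = Zer C T X'"
    using aa'g Comp_Zer[OF a(1) T] by simp
qed

end

section \<open>Coimages, normality and ICE-closed subcategories in an abelian category\<close>

context abelian_cat
begin

text \<open>The comparison arrow \<open>m\<close> out of the coimage exists since \<open>f\<close>
  kills its kernel. To see that it is mono, the cokernel \<open>q\<close> of an arrow
  \<open>g\<close> killed by \<open>m\<close> is shown to be split mono; as \<open>q\<close> kills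
  \<open>g\<close>, this forces \<open>g = 0\<close>.\<close>

lemma coimage_mono_factor:
  assumes f: "f \<in> Hom C X Y" and k: "is_kernel C f k" and e: "is_cokernel C k e"
  obtains m where "m \<in> Hom C (Cod C e) Y" "m \<cdot> e = f" "mono_arr C m"
proof -
  let ?P = "Cod C e"
  note kD = is_kernelD[OF k f]
  note eD = is_cokernelD[OF e kD(1)]
  obtain m where m: "m \<in> Hom C ?P Y" "m \<cdot> e = f"
    using eD(3)[OF f kD(2)] by blast
  have "mono_arr C m"
  proof (rule mono_arrI_Zer[OF m(1)])
    fix T g
    assume g: "g \<in> Hom C T ?P" and mg: "m \<cdot> g = Zer C T Y"
    have T: "T \<in> Obj C" and P: "?P \<in> Obj C"
      using Hom_Obj[OF g] by auto
    obtain q where q: "is_cokernel C g q"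
      using ex_cokernel[OF HomD(1)[OF g]] by blast
    note qD = is_cokernelD[OF q g]
    obtain m' where m': "m' \<in> Hom C (Cod C q) Y" "m' \<cdot> q = m"
      using qD(3)[OF m(1) mg] by blast
    have qe: "q \<cdot> e \<in> Hom C X (Cod C q)"
      using eD(1) qD(1) by (rule Comp_Hom)
    have "epi_arr C (q \<cdot> e)"
      using eD(1) qD(1) is_cokernel_epi[OF e] is_cokernel_epi[OF q] by (rule epi_arr_comp)
    \<comment> \<open>Normality of epis presents \<open>q \<cdot> e\<close> as a cokernel of some
      \<open>h\<close>. Since \<open>f\<close> factors through \<open>q \<cdot> e\<close>, it kills
      \<open>h\<close>; so \<open>h\<close> factors through \<open>k\<close> and is killed by
      \<open>e\<close>.\<close>
    then obtain h where h: "is_cokernel C h (q \<cdot> e)"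
      using epi_normal by blast
    obtain W where hW: "h \<in> Hom C W X"
      using h HomD[OF qe] by (auto simp: is_cokernel_def Hom_def)
    note hD = is_cokernelD[OF h hW]
    have W: "W \<in> Obj C"
      using hW by (rule Hom_Obj)
    have "f \<cdot> h = m' \<cdot> ((q \<cdot> e) \<cdot> h)"
      using Comp_assoc[OF hW qe m'(1)] Comp_assoc[OF eD(1) qD(1) m'(1)] m'(2) m(2) by simp
    also have "\<dots> = Zer C W Y"
      using hD(2) HomD[OF qe] Comp_Zer[OF m'(1) W] by simp
    finally obtain h' where h': "h' \<in> Hom C W (Dom C k)" "k \<cdot> h' = h"
      using kD(3)[OF hW] by blast
    have "e \<cdot> h = Zer C W ?P"
      using Comp_assoc[OF h'(1) kD(1) eD(1)] h'(2) eD(2) Zer_Comp[OF h'(1) P] by simp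
    \<comment> \<open>The universal property of \<open>q \<cdot> e\<close> now gives
      \<open>s\<close>; cancelling the epi \<open>e\<close> makes it a left inverse of
      \<open>q\<close>.\<close>
    then obtain s where s: "s \<in> Hom C (Cod C q) ?P" "s \<cdot> (q \<cdot> e) = e"
      using hD(3)[OF eD(1)] HomD[OF qe] by auto
    have "(s \<cdot> q) \<cdot> e = Idn C ?P \<cdot> e"
      using Comp_assoc[OF eD(1) qD(1) s(1)] s(2) Idn_left[OF eD(1)] by simp
    then have sq: "s \<cdot> q = Idn C ?P"
      by (rule epi_arr_cancel[OF is_cokernel_epi[OF e] eD(1) Comp_Hom[OF qD(1) s(1)] Idn_Hom[OF P]])
    show "g = Zer C T ?P"
      using Comp_assoc[OF g qD(1) s(1)] sq Idn_left[OF g] qD(2) Comp_Zer[OF s(1) T] by simp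
  qed
  with m show thesis
    by (rule that)
qed

text \<open>By normality \<open>m\<close> is a kernel of some \<open>g\<close>. As \<open>g\<close>
  kills \<open>m\<close>, it factors through \<open>c\<close>, so everything killed by
  \<open>c\<close> is killed by \<open>g\<close> and factors through \<open>m\<close>.\<close>

lemma is_kernel_of_cokernel:
  assumes m: "m \<in> Hom C X Y" "mono_arr C m" and c: "is_cokernel C m c"
  shows "is_kernel C c m"
proof -
  note cD = is_cokernelD[OF c m(1)]
  obtain g where g: "is_kernel C g m"
    using mono_normal m(2) by blast
  obtain Z where gZ: "g \<in> Hom C Y Z"
    using g HomD[OF m(1)] by (auto simp: is_kernel_def Hom_def)
  note gD = is_kernelD[OF g gZ]
  obtain g' where g': "g' \<in> Hom C (Cod C c) Z" "g' \<cdot> c = g"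
    using cD(3)[OF gZ] gD(2) HomD[OF m(1)] by auto
  show ?thesis
  proof (rule is_kernelI[OF cD(1) m(1) cD(2) m(2)])
    fix T h
    assume h: "h \<in> Hom C T Y" "c \<cdot> h = Zer C T (Cod C c)"
    have "g \<cdot> h = Zer C T Z"
      using Comp_assoc[OF h(1) cD(1) g'(1)] g'(2) h(2) Comp_Zer[OF g'(1) Hom_Obj(1)[OF h(1)]] by simp
    then show "\<exists>u \<in> Hom C T X. m \<cdot> u = h"
      using gD(3)[OF h(1)] HomD[OF m(1)] by auto
  qed
qed

text \<open>The image \<open>m\<close> of \<open>f\<close> is a kernel of both \<open>c\<close> and
  \<open>g\<close>, and \<open>g\<close> is a cokernel of some \<open>h\<close>. An arrow killing
  \<open>f\<close> factors through \<open>c\<close>, so it kills \<open>m\<close>, hence also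
  \<open>h\<close>, which factors through \<open>m\<close>; therefore it factors through
  \<open>g\<close>.\<close>

lemma short_exact_is_cokernel:
  assumes f: "f \<in> Hom C X Y" and g: "g \<in> Hom C Y Z" and "short_exact C f g"
  shows "is_cokernel C f g"
proof -
  obtain m c where c: "is_cokernel C f c" and cm: "is_kernel C c m" and gm: "is_kernel C g m"
    and epi: "epi_arr C g"
    using assms(3) by (auto simp: short_exact_def is_image_def)
  note cD = is_cokernelD[OF c f]
  note cmD = is_kernelD[OF cm cD(1)] and gmD = is_kernelD[OF gm g]
  obtain h where h: "is_cokernel C h g"
    using epi_normal[OF epi] by blast
  obtain W where hW: "h \<in> Hom C W Y"
    using h HomD[OF g] by (auto simp: is_cokernel_def Hom_def)
  note hD = is_cokernelD[OF h hW]
  obtain h' where h': "h' \<in> Hom C W (Dom C m)" "m \<cdot> h' = h"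
    using gmD(3)[OF hW] hD(2) HomD[OF g] by auto
  obtain f' where f': "f' \<in> Hom C X (Dom C m)" "m \<cdot> f' = f"
    using cmD(3)[OF f cD(2)] by blast
  show ?thesis
  proof (rule is_cokernelI[OF f g _ epi])
    show "g \<cdot> f = Zer C X Z"
      using Comp_assoc[OF f'(1) gmD(1) g] f'(2) gmD(2) Zer_Comp[OF f'(1) Hom_Obj(2)[OF g]] by simp
    fix T x
    assume x: "x \<in> Hom C Y T" "x \<cdot> f = Zer C X T"
    obtain y where y: "y \<in> Hom C (Cod C c) T" "y \<cdot> c = x"
      using cD(3)[OF x] by blast
    have "x \<cdot> m = Zer C (Dom C m) T"
      using Comp_assoc[OF cmD(1) cD(1) y(1)] y(2) cmD(2) Comp_Zer[OF y(1) Hom_Obj(1)[OF cmD(1)]]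
      by simp
    then have "x \<cdot> h = Zer C W T"
      using Comp_assoc[OF h'(1) gmD(1) x(1)] h'(2) Zer_Comp[OF h'(1) Hom_Obj(2)[OF x(1)]] by simp
    then show "\<exists>u \<in> Hom C Z T. u \<cdot> g = x"
      using hD(3)[OF x(1)] HomD[OF g] by auto
  qed
qed

text \<open>The cokernel of the identity of any member is a zero object, and all zero objects are
  isomorphic.\<close>

lemma ICE_closed_zero_obj:
  assumes "ICE_closed C S" "S \<noteq> {}" "zero_obj C Z"
  shows "Z \<in> S"
proof -
  obtain M where M: "M \<in> S" "M \<in> Obj C"
    using assms(1,2) by (auto simp: ICE_closed_def subcategory_def)
  have id: "Idn C M \<in> Hom C M M"
    using M(2) by (rule Idn_Hom)
  obtain c where c: "is_cokernel C (Idn C M) c"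
    using ex_cokernel[OF HomD(1)[OF id]] by blast
  have "Cod C c \<in> S"
    using assms(1) M(1) id c by (auto simp: ICE_closed_def)
  moreover have "zero_obj C (Cod C c)"
    using c section_epi_arr[OF id id Idn_left[OF id]] by (rule cokernel_of_epi_zero_obj)
  ultimately show ?thesis
    using assms(1) zero_obj_isomorphic[OF _ assms(3)] subcategory_isomorphic_iff
    by (auto simp: ICE_closed_def)
qed

lemma ICE_closed_target:
  assumes S: "ICE_closed C S" and f: "f \<in> Hom C X Y" "is_kernel C f k" "is_cokernel C f c"
    and "X \<in> S" "Dom C k \<in> S" "Cod C c \<in> S"
  shows "Y \<in> S"
proof -
  note k = is_kernelD[OF f(2,1)] and c = is_cokernelD[OF f(3,1)]
  obtain e where e: "is_cokernel C k e"
    using ex_cokernel[OF HomD(1)[OF k(1)]] by blast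
  note eD = is_cokernelD[OF e k(1)]
  \<comment> \<open>The coimage is a cokernel of \<open>k\<close>, an arrow between two members of
    \<open>S\<close>.\<close>
  have P: "Cod C e \<in> S"
    using S k(1) e \<open>X \<in> S\<close> \<open>Dom C k \<in> S\<close> by (auto simp: ICE_closed_def)
  obtain m where m: "m \<in> Hom C (Cod C e) Y" "m \<cdot> e = f" "mono_arr C m"
    using coimage_mono_factor[OF f(1,2) e] by blast
  \<comment> \<open>Since \<open>e\<close> is epi, an arrow kills \<open>m\<close> exactly when it
    kills \<open>f = m \<cdot> e\<close>, so \<open>f\<close> and \<open>m\<close> share their
    cokernel.\<close>
  have mc: "is_cokernel C m c"
  proof (rule is_cokernelI[OF m(1) c(1) _ is_cokernel_epi[OF f(3)]])
    have "(c \<cdot> m) \<cdot> e = Zer C (Cod C e) (Cod C c) \<cdot> e"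
      using Comp_assoc[OF eD(1) m(1) c(1)] m(2) c(2) Zer_Comp[OF eD(1) Hom_Obj(2)[OF c(1)]] by simp
    then show "c \<cdot> m = Zer C (Cod C e) (Cod C c)"
      by (rule epi_arr_cancel[OF is_cokernel_epi[OF e] eD(1) Comp_Hom[OF m(1) c(1)]
            Zer_Hom[OF Hom_Obj(2)[OF eD(1)] Hom_Obj(2)[OF c(1)]]])
    fix T h
    assume h: "h \<in> Hom C Y T" "h \<cdot> m = Zer C (Cod C e) T"
    have "h \<cdot> f = Zer C X T"
      using Comp_assoc[OF eD(1) m(1) h(1)] m(2) h(2) Zer_Comp[OF eD(1) Hom_Obj(2)[OF h(1)]] by simp
    then show "\<exists>u \<in> Hom C (Cod C c) T. u \<cdot> c = h"
      by (rule c(3)[OF h(1)])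
  qed
  have "is_kernel C c m"
    using m(1,3) mc by (rule is_kernel_of_cokernel)
  then have "short_exact C m c"
    using mc m(3) is_cokernel_epi[OF f(3)] by (auto simp: short_exact_def is_image_def)
  with S P \<open>Cod C c \<in> S\<close> m(1) c(1) show ?thesis
    unfolding ICE_closed_def by blast
qed

end

section \<open>Functors and adjunctions\<close>

context additive_functor
begin

lemma ar_Zer:
  assumes "X \<in> Obj C" "Y \<in> Obj C"
  shows "ar F (Zer C X Y) = Zer D (ob F X) (ob F Y)"
proof -
  interpret G: comm_group "hom_group C X Y"
    using assms by (rule C.hom_comm_group)
  interpret H: comm_group "hom_group D (ob F X) (ob F Y)"
    using assms by (intro D.hom_comm_group ob_Obj)
  show ?thesis
    using hom_one[OF ar_Add[OF assms] G.group_axioms H.group_axioms] by (simp add: hom_group_def)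
qed

lemma isomorphic_ob:
  assumes "isomorphic C X Y"
  shows "isomorphic D (ob F X) (ob F Y)"
proof -
  obtain f g where f: "f \<in> Hom C X Y" and g: "g \<in> Hom C Y X"
    and eq: "g \<cdot>\<^bsub>C\<^esub> f = Idn C X" "f \<cdot>\<^bsub>C\<^esub> g = Idn C Y"
    using assms by (auto simp: isomorphic_def)
  show ?thesis
    using ar_Comp[OF f g] ar_Comp[OF g f] eq C.Hom_Obj[OF f] ar_Idn
    by (intro isomorphicI[OF ar_Hom[OF f] ar_Hom[OF g]]) simp_all
qed

end

section \<open>Adjunctions, preservation of kernels and cokernels, and the unit\<close>

locale adjunction =
  F: additive_functor C D F + G: additive_functor D C G
  for C :: "('o1, 'm1) acat" and D :: "('o2, 'm2) acat"
    and F :: "('o1, 'm1, 'o2, 'm2) ftr" and G :: "('o2, 'm2, 'o1, 'm1) ftr" +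
  fixes \<phi> :: "'o1 \<Rightarrow> 'o2 \<Rightarrow> 'm2 \<Rightarrow> 'm1"
  assumes bij: "\<lbrakk>X \<in> Obj C; Y \<in> Obj D\<rbrakk>
      \<Longrightarrow> bij_betw (\<phi> X Y) (Hom D (ob F X) Y) (Hom C X (ob G Y))"
    and natural: "\<lbrakk>a \<in> Hom C X' X; b \<in> Hom D Y Y'; X \<in> Obj C; f \<in> Hom D (ob F X) Y\<rbrakk>
      \<Longrightarrow> \<phi> X' Y' (b \<cdot>\<^bsub>D\<^esub> f \<cdot>\<^bsub>D\<^esub> ar F a) = ar G b \<cdot>\<^bsub>C\<^esub> \<phi> X Y f \<cdot>\<^bsub>C\<^esub> a"

text \<open>The bijection that \<open>adjoint_pair\<close> only asserts to exist becomes a locale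
  parameter, so that the unit can be defined from it.\<close>

lemma adjunctionE:
  assumes "adjoint_pair C D F G" "additive_functor C D F" "additive_functor D C G"
  obtains \<phi> where "adjunction C D F G \<phi>"
proof -
  interpret F: additive_functor C D F by fact
  interpret G: additive_functor D C G by fact
  obtain \<phi> where bij: "\<forall>X \<in> Obj C. \<forall>Y \<in> Obj D.
        bij_betw (\<phi> X Y) (Hom D (ob F X) Y) (Hom C X (ob G Y))"
    and nat: "\<forall>X \<in> Obj C. \<forall>X' \<in> Obj C. \<forall>Y \<in> Obj D. \<forall>Y' \<in> Obj D.
        \<forall>a \<in> Hom C X' X. \<forall>b \<in> Hom D Y Y'. \<forall>f \<in> Hom D (ob F X) Y.
          \<phi> X' Y' (b \<cdot>\<^bsub>D\<^esub> f \<cdot>\<^bsub>D\<^esub> ar F a) = ar G b \<cdot>\<^bsub>C\<^esub> \<phi> X Y f \<cdot>\<^bsub>C\<^esub> a"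
    using assms(1) unfolding adjoint_pair_def by blast
  have "adjunction C D F G \<phi>"
  proof unfold_locales
    show "bij_betw (\<phi> X Y) (Hom D (ob F X) Y) (Hom C X (ob G Y))" if "X \<in> Obj C" "Y \<in> Obj D" for X Y
      using bij that by blast
    show "\<phi> X' Y' (b \<cdot>\<^bsub>D\<^esub> f \<cdot>\<^bsub>D\<^esub> ar F a) = ar G b \<cdot>\<^bsub>C\<^esub> \<phi> X Y f \<cdot>\<^bsub>C\<^esub> a"
      if "a \<in> Hom C X' X" "b \<in> Hom D Y Y'" "X \<in> Obj C" "f \<in> Hom D (ob F X) Y" for a b f X X' Y Y'
      using nat that F.C.Hom_Obj[OF that(1)] F.D.Hom_Obj[OF that(2)] by blast
  qed
  then show thesis
    by (rule that)
qed

context adjunction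
begin

lemma phi_Hom:
  assumes "X \<in> Obj C" "f \<in> Hom D (ob F X) Y"
  shows "\<phi> X Y f \<in> Hom C X (ob G Y)"
  using bij_betw_apply[OF bij[OF assms(1) F.D.Hom_Obj(2)[OF assms(2)]] assms(2)] .

lemma phi_inj:
  assumes "X \<in> Obj C" "f \<in> Hom D (ob F X) Y" "g \<in> Hom D (ob F X) Y" "\<phi> X Y f = \<phi> X Y g"
  shows "f = g"
  using bij_betw_imp_inj_on[OF bij[OF assms(1) F.D.Hom_Obj(2)[OF assms(2)]]] assms(4,2,3)
  by (rule inj_onD)

lemma phi_surj:
  assumes "g \<in> Hom C X (ob G Y)" "Y \<in> Obj D"
  obtains f where "f \<in> Hom D (ob F X) Y" "\<phi> X Y f = g"
proof -
  have "g \<in> \<phi> X Y ` Hom D (ob F X) Y"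
    using bij_betw_imp_surj_on[OF bij[OF F.C.Hom_Obj(1)[OF assms(1)] assms(2)]] assms(1) by simp
  then show thesis
    by (rule imageE) (simp add: that)
qed

lemma phi_post:
  assumes "X \<in> Obj C" "f \<in> Hom D (ob F X) Y" "b \<in> Hom D Y Y'"
  shows "\<phi> X Y' (b \<cdot>\<^bsub>D\<^esub> f) = ar G b \<cdot>\<^bsub>C\<^esub> \<phi> X Y f"
  using natural[OF F.C.Idn_Hom[OF assms(1)] assms(3,1,2)]
  unfolding F.ar_Idn[OF assms(1)] F.D.Idn_right[OF F.D.Comp_Hom[OF assms(2,3)]]
    F.C.Idn_right[OF F.C.Comp_Hom[OF phi_Hom[OF assms(1,2)] G.ar_Hom[OF assms(3)]]] .

lemma phi_pre:
  assumes "a \<in> Hom C X' X" "f \<in> Hom D (ob F X) Y"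
  shows "\<phi> X' Y (f \<cdot>\<^bsub>D\<^esub> ar F a) = \<phi> X Y f \<cdot>\<^bsub>C\<^esub> a"
proof -
  have X: "X \<in> Obj C" and Y: "Y \<in> Obj D"
    using F.C.Hom_Obj[OF assms(1)] F.D.Hom_Obj[OF assms(2)] by auto
  show ?thesis
    using natural[OF assms(1) F.D.Idn_Hom[OF Y] X assms(2)] G.ar_Idn[OF Y]
      F.D.Idn_left[OF assms(2)] F.C.Idn_left[OF phi_Hom[OF X assms(2)]] by simp
qed

text \<open>The locale does not assume that \<open>\<phi>\<close> is additive. It still preserves
  zero, because the zero arrow is its own composite with \<open>ar F\<close> of a zero arrow, and
  naturality turns this into a composite with zero.\<close>

lemma phi_Zer:
  assumes "X \<in> Obj C" "Y \<in> Obj D"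
  shows "\<phi> X Y (Zer D (ob F X) Y) = Zer C X (ob G Y)"
proof -
  have z: "Zer C X X \<in> Hom C X X" and w: "Zer D (ob F X) Y \<in> Hom D (ob F X) Y"
    using assms by (auto intro: F.C.Zer_Hom F.D.Zer_Hom F.ob_Obj)
  show ?thesis
    using phi_pre[OF z w] F.D.Zer_Comp[OF F.ar_Hom[OF z] assms(2)]
      F.C.Comp_Zer[OF phi_Hom[OF assms(1) w] assms(1)] by simp
qed

text \<open>Test arrows \<open>T \<rightarrow> G Y\<close> are transposed to
  \<open>F T \<rightarrow> Y\<close>, where the universal property of \<open>k\<close> applies, and
  the factorisation is transposed back.\<close>

lemma right_adjoint_is_kernel:
  assumes f: "f \<in> Hom D Y Z" and "is_kernel D f k"
  shows "is_kernel C (ar G f) (ar G k)"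
proof -
  note k = F.D.is_kernelD[OF assms(2,1)]
  have Y: "Y \<in> Obj D" and Z: "Z \<in> Obj D" and K: "Dom D k \<in> Obj D"
    using F.D.Hom_Obj[OF f] F.D.Hom_Obj[OF k(1)] by auto
  note Gf = G.ar_Hom[OF f] and Gk = G.ar_Hom[OF k(1)]
  show ?thesis
  proof (rule F.C.is_kernelI[OF Gf Gk])
    show "ar G f \<cdot>\<^bsub>C\<^esub> ar G k = Zer C (ob G (Dom D k)) (ob G Z)"
      using G.ar_Comp[OF k(1) f] k(2) G.ar_Zer[OF K Z] by simp
    show "mono_arr C (ar G k)"
      unfolding mono_arr_def HomD[OF Gk]
    proof (intro conjI allI ballI impI)
      show "ar G k \<in> Arr C"
        using Gk by (rule HomD)
      fix T g h
      assume g: "g \<in> Hom C T (ob G (Dom D k))" and h: "h \<in> Hom C T (ob G (Dom D k))"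
        and eq: "ar G k \<cdot>\<^bsub>C\<^esub> g = ar G k \<cdot>\<^bsub>C\<^esub> h"
      have T: "T \<in> Obj C"
        using g by (rule F.C.Hom_Obj)
      obtain u where u: "u \<in> Hom D (ob F T) (Dom D k)" "\<phi> T (Dom D k) u = g"
        using g K by (rule phi_surj)
      obtain v where v: "v \<in> Hom D (ob F T) (Dom D k)" "\<phi> T (Dom D k) v = h"
        using h K by (rule phi_surj)
      have "k \<cdot>\<^bsub>D\<^esub> u = k \<cdot>\<^bsub>D\<^esub> v"
        using phi_post[OF T u(1) k(1)] phi_post[OF T v(1) k(1)] u v eq
        by (intro phi_inj[OF T F.D.Comp_Hom[OF u(1) k(1)] F.D.Comp_Hom[OF v(1) k(1)]]) simp
      then have "u = v"
        by (rule F.D.mono_arr_cancel[OF F.D.is_kernel_mono[OF assms(2)] k(1) u(1) v(1)])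
      with u v show "g = h"
        by simp
    qed
    fix T h
    assume h: "h \<in> Hom C T (ob G Y)" "ar G f \<cdot>\<^bsub>C\<^esub> h = Zer C T (ob G Z)"
    have T: "T \<in> Obj C"
      using h(1) by (rule F.C.Hom_Obj)
    obtain x where x: "x \<in> Hom D (ob F T) Y" "\<phi> T Y x = h"
      using h(1) Y by (rule phi_surj)
    have "f \<cdot>\<^bsub>D\<^esub> x = Zer D (ob F T) Z"
      using phi_post[OF T x(1) f] x(2) h(2) phi_Zer[OF T Z]
      by (intro phi_inj[OF T F.D.Comp_Hom[OF x(1) f] F.D.Zer_Hom[OF F.ob_Obj[OF T] Z]]) simp
    then obtain u where u: "u \<in> Hom D (ob F T) (Dom D k)" "k \<cdot>\<^bsub>D\<^esub> u = x"
      using k(3)[OF x(1)] by blast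
    show "\<exists>u \<in> Hom C T (ob G (Dom D k)). ar G k \<cdot>\<^bsub>C\<^esub> u = h"
      using phi_post[OF T u(1) k(1)] u(2) x(2) phi_Hom[OF T u(1)] by auto
  qed
qed

text \<open>Dual transposition: a test arrow out of \<open>F Y\<close> becomes one out of
  \<open>Y\<close>, where \<open>c\<close> is universal.\<close>

lemma left_adjoint_is_cokernel:
  assumes f: "f \<in> Hom C X Y" and "is_cokernel C f c"
  shows "is_cokernel D (ar F f) (ar F c)"
proof -
  note c = F.C.is_cokernelD[OF assms(2,1)]
  have X: "X \<in> Obj C" and Y: "Y \<in> Obj C" and Z: "Cod C c \<in> Obj C"
    using F.C.Hom_Obj[OF f] F.C.Hom_Obj[OF c(1)] by auto
  note Ff = F.ar_Hom[OF f] and Fc = F.ar_Hom[OF c(1)]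
  show ?thesis
  proof (rule F.D.is_cokernelI[OF Ff Fc])
    show "ar F c \<cdot>\<^bsub>D\<^esub> ar F f = Zer D (ob F X) (ob F (Cod C c))"
      using F.ar_Comp[OF f c(1)] c(2) F.ar_Zer[OF X Z] by simp
    show "epi_arr D (ar F c)"
      unfolding epi_arr_def HomD[OF Fc]
    proof (intro conjI allI ballI impI)
      show "ar F c \<in> Arr D"
        using Fc by (rule HomD)
      fix T g h
      assume g: "g \<in> Hom D (ob F (Cod C c)) T" and h: "h \<in> Hom D (ob F (Cod C c)) T"
        and eq: "g \<cdot>\<^bsub>D\<^esub> ar F c = h \<cdot>\<^bsub>D\<^esub> ar F c"
      have "\<phi> (Cod C c) T g \<cdot>\<^bsub>C\<^esub> c = \<phi> (Cod C c) T h \<cdot>\<^bsub>C\<^esub> c"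
        using phi_pre[OF c(1) g] phi_pre[OF c(1) h] eq by simp
      then have "\<phi> (Cod C c) T g = \<phi> (Cod C c) T h"
        by (rule F.C.epi_arr_cancel[OF F.C.is_cokernel_epi[OF assms(2)] c(1)
              phi_Hom[OF Z g] phi_Hom[OF Z h]])
      then show "g = h"
        by (rule phi_inj[OF Z g h])
    qed
    fix T h
    assume h: "h \<in> Hom D (ob F Y) T" "h \<cdot>\<^bsub>D\<^esub> ar F f = Zer D (ob F X) T"
    have T: "T \<in> Obj D"
      using h(1) by (rule F.D.Hom_Obj)
    have "\<phi> Y T h \<cdot>\<^bsub>C\<^esub> f = Zer C X (ob G T)"
      using phi_pre[OF f h(1)] h(2) phi_Zer[OF X T] by simp
    then obtain u where u: "u \<in> Hom C (Cod C c) (ob G T)" "u \<cdot>\<^bsub>C\<^esub> c = \<phi> Y T h"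
      using c(3)[OF phi_Hom[OF Y h(1)]] by blast
    obtain v where v: "v \<in> Hom D (ob F (Cod C c)) T" "\<phi> (Cod C c) T v = u"
      using u(1) T by (rule phi_surj)
    have "v \<cdot>\<^bsub>D\<^esub> ar F c = h"
      using phi_pre[OF c(1) v(1)] u(2) v(2)
      by (intro phi_inj[OF Y F.D.Comp_Hom[OF Fc v(1)] h(1)]) simp
    with v(1) show "\<exists>u \<in> Hom D (ob F (Cod C c)) T. u \<cdot>\<^bsub>D\<^esub> ar F c = h"
      by blast
  qed
qed

definition \<eta> :: "'o1 \<Rightarrow> 'm1" where
  "\<eta> X = \<phi> X (ob F X) (Idn D (ob F X))"

lemma unit_Hom: "X \<in> Obj C \<Longrightarrow> \<eta> X \<in> Hom C X (ob G (ob F X))"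
  by (simp add: \<eta>_def phi_Hom F.D.Idn_Hom F.ob_Obj)

text \<open>Composition with \<open>\<eta> Y\<close> is thus \<open>ar F\<close> followed by a
  bijection, which is how full faithfulness of \<open>F\<close> comes to bear on the unit.\<close>

lemma unit_Comp:
  assumes "f \<in> Hom C X Y"
  shows "\<eta> Y \<cdot>\<^bsub>C\<^esub> f = \<phi> X (ob F Y) (ar F f)"
  using phi_pre[OF assms F.D.Idn_Hom] F.ob_Obj F.C.Hom_Obj[OF assms]
    F.D.Idn_left[OF F.ar_Hom[OF assms]] by (simp add: \<eta>_def)

lemma Comp_unit:
  assumes "X \<in> Obj C" "g \<in> Hom D (ob F X) Y"
  shows "ar G g \<cdot>\<^bsub>C\<^esub> \<eta> X = \<phi> X Y g"
  using phi_post[OF assms(1) F.D.Idn_Hom assms(2)] F.ob_Obj assms(1)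
    F.D.Idn_right[OF assms(2)] by (simp add: \<eta>_def)

lemma unit_natural:
  assumes "f \<in> Hom C X Y"
  shows "\<eta> Y \<cdot>\<^bsub>C\<^esub> f = ar G (ar F f) \<cdot>\<^bsub>C\<^esub> \<eta> X"
  using unit_Comp[OF assms] Comp_unit[OF _ F.ar_Hom[OF assms]] F.C.Hom_Obj[OF assms] by simp

end

text \<open>A fully faithful left adjoint embeds \<open>C\<close> as a coreflective subcategory of
  \<open>D\<close>. The instance used below is \<open>j_lsh\<close> with right adjoint
  \<open>j_us\<close>.\<close>

locale coreflection = adjunction +
  assumes ff: "fully_faithful C D F"
begin

lemma unit_iso:
  assumes X: "X \<in> Obj C"
  obtains s where "s \<in> Hom C (ob G (ob F X)) X" "s \<cdot>\<^bsub>C\<^esub> \<eta> X = Idn C X"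
    "\<eta> X \<cdot>\<^bsub>C\<^esub> s = Idn C (ob G (ob F X))"
proof -
  let ?Y = "ob G (ob F X)"
  have FX: "ob F X \<in> Obj D" and Y: "?Y \<in> Obj C"
    using X by (auto intro: F.ob_Obj G.ob_Obj)
  have FF: "bij_betw (ar F) (Hom C T X) (Hom D (ob F T) (ob F X))" if "T \<in> Obj C" for T
    using ff that X by (auto simp: fully_faithful_def)
  \<comment> \<open>The transpose of the identity of \<open>?Y\<close> has the form
    \<open>ar F s\<close> by fullness; by \<open>unit_Comp\<close> this \<open>s\<close> is a right
    inverse of the unit.\<close>
  obtain g where g: "g \<in> Hom D (ob F ?Y) (ob F X)" "\<phi> ?Y (ob F X) g = Idn C ?Y"
    using F.C.Idn_Hom[OF Y] FX by (rule phi_surj)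
  obtain s where s: "s \<in> Hom C ?Y X" "ar F s = g"
    using bij_betw_imp_surj_on[OF FF[OF Y]] g(1) by (metis imageE)
  have es: "\<eta> X \<cdot>\<^bsub>C\<^esub> s = Idn C ?Y"
    using unit_Comp[OF s(1)] s(2) g(2) by simp
  note e = unit_Hom[OF X] and id = F.C.Idn_Hom[OF X]
  have se: "s \<cdot>\<^bsub>C\<^esub> \<eta> X \<in> Hom C X X"
    using e s(1) by (rule F.C.Comp_Hom)
  \<comment> \<open>For the other side, \<open>\<eta> X\<close> is cancelled on the left:
    \<open>\<phi>\<close> and, by faithfulness, \<open>ar F\<close> are injective.\<close>
  have "\<eta> X \<cdot>\<^bsub>C\<^esub> (s \<cdot>\<^bsub>C\<^esub> \<eta> X) = \<eta> X \<cdot>\<^bsub>C\<^esub> Idn C X"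
    using F.C.Comp_assoc[OF e s(1) e] es F.C.Idn_left[OF e] F.C.Idn_right[OF e] by simp
  then have "\<phi> X (ob F X) (ar F (s \<cdot>\<^bsub>C\<^esub> \<eta> X)) = \<phi> X (ob F X) (ar F (Idn C X))"
    using unit_Comp[OF se] unit_Comp[OF id] by simp
  then have "ar F (s \<cdot>\<^bsub>C\<^esub> \<eta> X) = ar F (Idn C X)"
    by (rule phi_inj[OF X F.ar_Hom[OF se] F.ar_Hom[OF id]])
  then have "s \<cdot>\<^bsub>C\<^esub> \<eta> X = Idn C X"
    using inj_onD[OF bij_betw_imp_inj_on[OF FF[OF X]] _ se id] by blast
  with s(1) show thesis
    using es by (rule that)
qed

lemma unit_isomorphic: "X \<in> Obj C \<Longrightarrow> isomorphic C X (ob G (ob F X))"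
  by (metis isomorphicI unit_Hom unit_iso)

text \<open>The arrow is the counit, and \<open>G\<close> inverts it. This is recorded as mono and
  epi, the form in which its kernel and cokernel are shown to vanish under \<open>G\<close>.\<close>

lemma counit_ex:
  assumes M: "M \<in> Obj D"
  obtains \<epsilon> where "\<epsilon> \<in> Hom D (ob F (ob G M)) M" "mono_arr C (ar G \<epsilon>)" "epi_arr C (ar G \<epsilon>)"
proof -
  have GM: "ob G M \<in> Obj C"
    using M by (rule G.ob_Obj)
  obtain \<epsilon> where \<epsilon>: "\<epsilon> \<in> Hom D (ob F (ob G M)) M" "\<phi> (ob G M) M \<epsilon> = Idn C (ob G M)"
    using F.C.Idn_Hom[OF GM] M by (rule phi_surj)
  note G\<epsilon> = G.ar_Hom[OF \<epsilon>(1)] and e = unit_Hom[OF GM]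
  have ge: "ar G \<epsilon> \<cdot>\<^bsub>C\<^esub> \<eta> (ob G M) = Idn C (ob G M)"
    using Comp_unit[OF GM \<epsilon>(1)] \<epsilon>(2) by simp
  obtain s where s: "s \<in> Hom C (ob G (ob F (ob G M))) (ob G M)"
    "\<eta> (ob G M) \<cdot>\<^bsub>C\<^esub> s = Idn C (ob G (ob F (ob G M)))"
    using unit_iso[OF GM] by blast
  \<comment> \<open>A left inverse of the unit (the triangle identity \<open>ge\<close>) must
    coincide with its right inverse \<open>s\<close>.\<close>
  have "ar G \<epsilon> = (ar G \<epsilon> \<cdot>\<^bsub>C\<^esub> \<eta> (ob G M)) \<cdot>\<^bsub>C\<^esub> s"
    using F.C.Comp_assoc[OF s(1) e G\<epsilon>] s(2) F.C.Idn_right[OF G\<epsilon>] by simp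
  also have "\<dots> = s"
    using ge F.C.Idn_left[OF s(1)] by simp
  finally have "\<eta> (ob G M) \<cdot>\<^bsub>C\<^esub> ar G \<epsilon> = Idn C (ob G (ob F (ob G M)))"
    using s(2) by simp
  then show thesis
    using that[OF \<epsilon>(1)] F.C.retraction_mono_arr[OF G\<epsilon> e] F.C.section_epi_arr[OF G\<epsilon> e ge] by blast
qed

text \<open>By naturality of the unit, \<open>ar G (ar F f)\<close> is conjugate to \<open>f\<close>
  along invertible arrows.\<close>

lemma mono_unit_conjugate:
  assumes f: "f \<in> Hom C X Y" "mono_arr C f"
  shows "mono_arr C (ar G (ar F f))"
proof -
  have X: "X \<in> Obj C" and Y: "Y \<in> Obj C"
    using F.C.Hom_Obj[OF f(1)] by auto
  obtain s where s: "s \<in> Hom C (ob G (ob F X)) X" "\<eta> X \<cdot>\<^bsub>C\<^esub> s = Idn C (ob G (ob F X))"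
    using unit_iso[OF X] by blast
  obtain t where t: "t \<in> Hom C (ob G (ob F Y)) Y" "t \<cdot>\<^bsub>C\<^esub> \<eta> Y = Idn C Y"
    using unit_iso[OF Y] by blast
  show ?thesis
    using f G.ar_Hom[OF F.ar_Hom[OF f(1)]] unit_Hom[OF X] s unit_Hom[OF Y]
      F.C.retraction_mono_arr[OF unit_Hom[OF Y] t] unit_natural[OF f(1)]
    by (rule F.C.mono_arr_conjugate)
qed

lemma kernel_unit_conjugate:
  assumes f: "f \<in> Hom C X Y" and k: "is_kernel C f k" and k': "is_kernel C (ar G (ar F f)) k'"
  shows "isomorphic C (Dom C k) (Dom C k')"
proof -
  have X: "X \<in> Obj C" and Y: "Y \<in> Obj C"
    using F.C.Hom_Obj[OF f(1)] by auto
  obtain s where s: "s \<in> Hom C (ob G (ob F X)) X" "s \<cdot>\<^bsub>C\<^esub> \<eta> X = Idn C X"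
    "\<eta> X \<cdot>\<^bsub>C\<^esub> s = Idn C (ob G (ob F X))"
    using unit_iso[OF X] by blast
  obtain t where t: "t \<in> Hom C (ob G (ob F Y)) Y" "t \<cdot>\<^bsub>C\<^esub> \<eta> Y = Idn C Y"
    "\<eta> Y \<cdot>\<^bsub>C\<^esub> t = Idn C (ob G (ob F Y))"
    using unit_iso[OF Y] by blast
  show ?thesis
    using f k G.ar_Hom[OF F.ar_Hom[OF f]] k' unit_Hom[OF X] s unit_Hom[OF Y] t unit_natural[OF f]
    by (rule F.C.kernels_isomorphic)
qed

end

section \<open>Recollements\<close>

context recollement
begin

lemma coreflection_ex: "\<exists>\<phi>. coreflection A'' A j_lsh j_us \<phi>"
proof -
  obtain \<phi> where "adjunction A'' A j_lsh j_us \<phi>"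
    using adj_j_lsh_j_us j_lsh.additive_functor_axioms j_us.additive_functor_axioms
    by (rule adjunctionE)
  then show ?thesis
    using ff_j_lsh by (auto intro: coreflection.intro coreflection_axioms.intro)
qed

lemma j_us_is_kernel:
  assumes "f \<in> Hom A M N" "is_kernel A f k"
  shows "is_kernel A'' (ar j_us f) (ar j_us k)"
proof -
  obtain \<phi> where "coreflection A'' A j_lsh j_us \<phi>"
    using coreflection_ex by blast
  then interpret coreflection A'' A j_lsh j_us \<phi> .
  show ?thesis
    using assms by (rule right_adjoint_is_kernel)
qed

lemma j_us_is_cokernel:
  assumes "f \<in> Hom A M N" "is_cokernel A f c"
  shows "is_cokernel A'' (ar j_us f) (ar j_us c)"
proof -
  obtain \<phi> where "adjunction A A'' j_us j_ls \<phi>"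
    using adj_j_us_j_ls j_us.additive_functor_axioms j_ls.additive_functor_axioms
    by (rule adjunctionE)
  then interpret adjunction A A'' j_us j_ls \<phi> .
  show ?thesis
    using assms by (rule left_adjoint_is_cokernel)
qed

lemma j_us_is_image:
  assumes f: "f \<in> Hom A M N" and "is_image A f m"
  shows "is_image A'' (ar j_us f) (ar j_us m)"
proof -
  obtain c where c: "is_cokernel A f c" "is_kernel A c m"
    using assms(2) by (auto simp: is_image_def)
  then show ?thesis
    using j_us_is_cokernel[OF f c(1)] j_us_is_kernel[OF A.is_cokernelD(1)[OF c(1) f] c(2)]
    by (auto simp: is_image_def)
qed

text \<open>Normality makes \<open>f\<close> a kernel, and \<open>j_us\<close> preserves
  kernels.\<close>

lemma j_us_mono:
  assumes "f \<in> Hom A M N" "mono_arr A f"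
  shows "mono_arr A'' (ar j_us f)"
proof -
  obtain g where g: "is_kernel A g f"
    using A.mono_normal[OF assms(2)] by blast
  then have "g \<in> Hom A (Dom A g) (Cod A g)"
    by (simp add: is_kernel_def Arr_Hom)
  then show ?thesis
    using j_us_is_kernel g A''.is_kernel_mono by blast
qed

lemma j_us_epi:
  assumes "f \<in> Hom A M N" "epi_arr A f"
  shows "epi_arr A'' (ar j_us f)"
proof -
  obtain g where g: "is_cokernel A g f"
    using A.epi_normal[OF assms(2)] by blast
  then have "g \<in> Hom A (Dom A g) (Cod A g)"
    by (simp add: is_cokernel_def Arr_Hom)
  then show ?thesis
    using j_us_is_cokernel g A''.is_cokernel_epi by blast
qed

lemma j_us_short_exact:
  assumes f: "f \<in> Hom A M N" and g: "g \<in> Hom A N P" and "short_exact A f g"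
  shows "short_exact A'' (ar j_us f) (ar j_us g)"
  using assms(3) j_us_mono[OF f] j_us_epi[OF g] j_us_is_image[OF f] j_us_is_kernel[OF g]
  by (auto simp: short_exact_def)

section \<open>From subcategories of \<open>A''\<close> to their preimages in
  \<open>A\<close>\<close>

lemma j_us_Dom:
  assumes "f \<in> Hom A M N"
  shows "Dom A'' (ar j_us f) = ob j_us M" "Cod A'' (ar j_us f) = ob j_us N"
  using HomD[OF j_us.ar_Hom[OF assms]] by auto

lemma ICE_closed_preimage:
  assumes W: "ICE_closed A'' \<W>"
  shows "ICE_closed A {M \<in> Obj A. ob j_us M \<in> \<W>}" (is "ICE_closed A ?S")
  unfolding ICE_closed_def
proof (intro conjI ballI allI impI)
  have sub: "subcategory A'' \<W>"
    using W by (simp add: ICE_closed_def)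
  show "subcategory A ?S"
    unfolding subcategory_def
    using A''.subcategory_isomorphic_iff[OF sub] j_us.isomorphic_ob by blast
next
  fix M N f m
  assume MN: "M \<in> ?S" "N \<in> ?S" and f: "f \<in> Hom A M N" and m: "is_image A f m"
  obtain c where c: "is_cokernel A f c" "is_kernel A c m"
    using m by (auto simp: is_image_def)
  note m' = A.is_kernelD(1)[OF c(2) A.is_cokernelD(1)[OF c(1) f]]
  have "Dom A'' (ar j_us m) \<in> \<W>"
    using W MN j_us.ar_Hom[OF f] j_us_is_image[OF f m] unfolding ICE_closed_def by blast
  then show "Dom A m \<in> ?S"
    using j_us_Dom[OF m'] A.Hom_Obj[OF m'] by simp
next
  fix M N f c
  assume MN: "M \<in> ?S" "N \<in> ?S" and f: "f \<in> Hom A M N" and c: "is_cokernel A f c"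
  note c' = A.is_cokernelD(1)[OF c f]
  have "Cod A'' (ar j_us c) \<in> \<W>"
    using W MN j_us.ar_Hom[OF f] j_us_is_cokernel[OF f c] unfolding ICE_closed_def by blast
  then show "Cod A c \<in> ?S"
    using j_us_Dom[OF c'] A.Hom_Obj[OF c'] by simp
next
  fix L M N f g
  assume f: "f \<in> Hom A L M" and g: "g \<in> Hom A M N" and "short_exact A f g" "L \<in> ?S" "N \<in> ?S"
  then have "ob j_us M \<in> \<W>"
    using W j_us.ar_Hom[OF f] j_us.ar_Hom[OF g] j_us_short_exact[OF f g]
    unfolding ICE_closed_def by blast
  then show "M \<in> ?S"
    using A.Hom_Obj[OF f] by simp
qed

lemma j_us_j_lsh_isomorphic:
  assumes "X \<in> Obj A''"
  shows "isomorphic A'' X (ob j_us (ob j_lsh X))"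
proof -
  obtain \<phi> where "coreflection A'' A j_lsh j_us \<phi>"
    using coreflection_ex by blast
  then show ?thesis
    using assms by (rule coreflection.unit_isomorphic)
qed

text \<open>Objects in the image of \<open>i_ls\<close> are sent by \<open>j_us\<close> to zero
  objects, which lie in every nonempty ICE-closed subcategory. The second inclusion holds because
  \<open>j_us\<close> after \<open>j_lsh\<close> fixes objects up to isomorphism.\<close>

lemma preimage_contains:
  assumes W: "ICE_closed A'' \<W>" "\<W> \<noteq> {}"
  shows "ess_image A i_ls (Obj A') \<subseteq> {M \<in> Obj A. ob j_us M \<in> \<W>}"
    and "ess_image A (ftr_comp j_lsh j_us) {M \<in> Obj A. ob j_us M \<in> \<W>}
           \<subseteq> {M \<in> Obj A. ob j_us M \<in> \<W>}"
proof -
  have sub: "subcategory A'' \<W>"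
    using W by (simp add: ICE_closed_def)
  show "ess_image A i_ls (Obj A') \<subseteq> {M \<in> Obj A. ob j_us M \<in> \<W>}"
    using A''.ICE_closed_zero_obj[OF W] ker_j_us by auto
  show "ess_image A (ftr_comp j_lsh j_us) {M \<in> Obj A. ob j_us M \<in> \<W>}
           \<subseteq> {M \<in> Obj A. ob j_us M \<in> \<W>}"
  proof
    fix N
    assume "N \<in> ess_image A (ftr_comp j_lsh j_us) {M \<in> Obj A. ob j_us M \<in> \<W>}"
    then obtain M where M: "M \<in> Obj A" "ob j_us M \<in> \<W>" "N \<in> Obj A"
      "isomorphic A (ob j_lsh (ob j_us M)) N"
      by (auto simp: ess_image_def ftr_comp_def)
    have "ob j_us (ob j_lsh (ob j_us M)) \<in> \<W>"
      using A''.subcategory_isomorphic_iff[OF sub j_us_j_lsh_isomorphic[OF j_us.ob_Obj[OF M(1)]]] M(2)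
      by simp
    then have "ob j_us N \<in> \<W>"
      using A''.subcategory_isomorphic_iff[OF sub j_us.isomorphic_ob[OF M(4)]] by simp
    with M(3) show "N \<in> {M \<in> Obj A. ob j_us M \<in> \<W>}"
      by simp
  qed
qed

text \<open>Every \<open>X\<close> in \<open>\<W>\<close> is hit, up to isomorphism, by
  \<open>ob j_lsh X\<close>.\<close>

lemma ess_image_preimage:
  assumes "subcategory A'' \<W>"
  shows "ess_image A'' j_us {M \<in> Obj A. ob j_us M \<in> \<W>} = \<W>"
proof (intro equalityI subsetI)
  fix X
  assume "X \<in> ess_image A'' j_us {M \<in> Obj A. ob j_us M \<in> \<W>}"
  then show "X \<in> \<W>"
    using A''.subcategory_isomorphic_iff[OF assms] by (auto simp: ess_image_def)
next
  fix X
  assume X: "X \<in> \<W>"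
  then have X': "X \<in> Obj A''"
    using assms by (auto simp: subcategory_def)
  note iso = j_us_j_lsh_isomorphic[OF X']
  have "ob j_us (ob j_lsh X) \<in> \<W>"
    using A''.subcategory_isomorphic_iff[OF assms iso] X by simp
  then show "X \<in> ess_image A'' j_us {M \<in> Obj A. ob j_us M \<in> \<W>}"
    using X' j_lsh.ob_Obj[OF X'] isomorphic_sym[OF iso] by (auto simp: ess_image_def)
qed

section \<open>From subcategories of \<open>A\<close> to their essential images in
  \<open>A''\<close>\<close>

context
  fixes \<C>
  assumes C: "ICE_closed A \<C>" "ess_image A i_ls (Obj A') \<subseteq> \<C>"
    "ess_image A (ftr_comp j_lsh j_us) \<C> \<subseteq> \<C>"
begin

lemma C_subcategory: "subcategory A \<C>"
  using C(1) by (simp add: ICE_closed_def)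

lemma C_Obj: "M \<in> \<C> \<Longrightarrow> M \<in> Obj A"
  using C_subcategory by (auto simp: subcategory_def)

lemma zero_obj_j_us_in_C: "M \<in> Obj A \<Longrightarrow> zero_obj A'' (ob j_us M) \<Longrightarrow> M \<in> \<C>"
  using C(2) ker_j_us by auto

text \<open>Stability of \<open>\<C>\<close> under \<open>j_lsh\<close> after \<open>j_us\<close>
  gives one inclusion, the unit the other. Membership in the essential image can then be tested on
  the canonical lift \<open>ob j_lsh X\<close>.\<close>

lemma ess_image_eq: "ess_image A'' j_us \<C> = {X \<in> Obj A''. ob j_lsh X \<in> \<C>}"
proof (intro equalityI subsetI)
  fix X
  assume "X \<in> ess_image A'' j_us \<C>"
  then obtain M where M: "X \<in> Obj A''" "M \<in> \<C>" "isomorphic A'' (ob j_us M) X"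
    by (auto simp: ess_image_def)
  have "ob j_lsh (ob j_us M) \<in> Obj A"
    using C_Obj[OF M(2)] by (intro j_lsh.ob_Obj j_us.ob_Obj)
  then have "ob j_lsh (ob j_us M) \<in> \<C>"
    using C(3) M(2) A.isomorphic_refl by (force simp: ess_image_def ftr_comp_def)
  then show "X \<in> {X \<in> Obj A''. ob j_lsh X \<in> \<C>}"
    using A.subcategory_isomorphic_iff[OF C_subcategory j_lsh.isomorphic_ob[OF M(3)]] M(1) by simp
next
  fix X
  assume "X \<in> {X \<in> Obj A''. ob j_lsh X \<in> \<C>}"
  then show "X \<in> ess_image A'' j_us \<C>"
    using isomorphic_sym[OF j_us_j_lsh_isomorphic] by (auto simp: ess_image_def)
qed

lemma preimage_ess_image: "{M \<in> Obj A. ob j_us M \<in> ess_image A'' j_us \<C>} = \<C>"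
proof (intro equalityI subsetI)
  fix M
  assume "M \<in> \<C>"
  then show "M \<in> {M \<in> Obj A. ob j_us M \<in> ess_image A'' j_us \<C>}"
    using C_Obj j_us.ob_Obj A''.isomorphic_refl by (auto simp: ess_image_def)
next
  fix M
  assume "M \<in> {M \<in> Obj A. ob j_us M \<in> ess_image A'' j_us \<C>}"
  then have M: "M \<in> Obj A" "ob j_lsh (ob j_us M) \<in> \<C>"
    by (auto simp: ess_image_eq)
  obtain \<phi> where "coreflection A'' A j_lsh j_us \<phi>"
    using coreflection_ex by blast
  then obtain \<epsilon> where \<epsilon>: "\<epsilon> \<in> Hom A (ob j_lsh (ob j_us M)) M"
    "mono_arr A'' (ar j_us \<epsilon>)" "epi_arr A'' (ar j_us \<epsilon>)"
    using coreflection.counit_ex M(1) by metis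
  obtain k where k: "is_kernel A \<epsilon> k"
    using A.ex_kernel[OF HomD(1)[OF \<epsilon>(1)]] by blast
  obtain c where c: "is_cokernel A \<epsilon> c"
    using A.ex_cokernel[OF HomD(1)[OF \<epsilon>(1)]] by blast
  note kD = A.is_kernelD(1)[OF k \<epsilon>(1)] and cD = A.is_cokernelD(1)[OF c \<epsilon>(1)]
  \<comment> \<open>By exactness, \<open>ar j_us k\<close> is a kernel of the mono
    \<open>ar j_us \<epsilon>\<close>; dually for the cokernel. So both objects lie in the kernel of
    \<open>j_us\<close>, hence in \<open>\<C>\<close>.\<close>
  have "zero_obj A'' (ob j_us (Dom A k))"
    using A''.kernel_of_mono_zero_obj[OF j_us_is_kernel[OF \<epsilon>(1) k] \<epsilon>(2)] j_us_Dom[OF kD] by simp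
  moreover have "zero_obj A'' (ob j_us (Cod A c))"
    using A''.cokernel_of_epi_zero_obj[OF j_us_is_cokernel[OF \<epsilon>(1) c] \<epsilon>(3)] j_us_Dom[OF cD] by simp
  ultimately show "M \<in> \<C>"
    using A.ICE_closed_target[OF C(1) \<epsilon>(1) k c M(2)] zero_obj_j_us_in_C A.Hom_Obj kD cD by blast
qed

lemma ICE_closed_ess_image: "ICE_closed A'' (ess_image A'' j_us \<C>)" (is "ICE_closed A'' ?W")
proof -
  obtain \<phi> where "coreflection A'' A j_lsh j_us \<phi>"
    using coreflection_ex by blast
  then interpret J: coreflection A'' A j_lsh j_us \<phi> .
  have sub: "subcategory A'' ?W"
    unfolding subcategory_def ess_image_eq
    using A.subcategory_isomorphic_iff[OF C_subcategory j_lsh.isomorphic_ob] by blast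
  show ?thesis
    unfolding ICE_closed_def
  proof (intro conjI ballI allI impI)
    show "subcategory A'' ?W"
      by (rule sub)
  next
    fix X Y f m
    assume "X \<in> ?W" "Y \<in> ?W" and f: "f \<in> Hom A'' X Y" and m: "is_image A'' f m"
    then have XY: "ob j_lsh X \<in> \<C>" "ob j_lsh Y \<in> \<C>"
      by (auto simp: ess_image_eq)
    obtain c where c: "is_cokernel A'' f c" "is_kernel A'' c m"
      using m by (auto simp: is_image_def)
    note cD = A''.is_cokernelD(1)[OF c(1) f]
    note Fc = j_lsh.ar_Hom[OF cD]
    \<comment> \<open>As a left adjoint, \<open>j_lsh\<close> preserves the cokernel
      \<open>c\<close> but need not preserve its kernel \<open>m\<close>. The image is therefore
      formed anew in \<open>A\<close>, and \<open>j_us\<close> brings it back to the image in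
      \<open>A''\<close> by comparing kernels along the unit.\<close>
    obtain m' where m': "is_kernel A (ar j_lsh c) m'"
      using A.ex_kernel[OF HomD(1)[OF Fc]] by blast
    note m'D = A.is_kernelD(1)[OF m' Fc]
    have "is_image A (ar j_lsh f) m'"
      using J.left_adjoint_is_cokernel[OF f c(1)] m' by (auto simp: is_image_def)
    then have "Dom A m' \<in> \<C>"
      using C(1) XY j_lsh.ar_Hom[OF f] unfolding ICE_closed_def by blast
    moreover have "isomorphic A'' (Dom A'' m) (ob j_us (Dom A m'))"
      using J.kernel_unit_conjugate[OF cD c(2) j_us_is_kernel[OF Fc m']] j_us_Dom[OF m'D] by simp
    moreover have "Dom A'' m \<in> Obj A''"
      using A''.is_kernelD(1)[OF c(2) cD] by (rule A''.Hom_Obj)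
    ultimately show "Dom A'' m \<in> ?W"
      by (auto simp: ess_image_def intro: isomorphic_sym)
  next
    fix X Y f c
    assume "X \<in> ?W" "Y \<in> ?W" and f: "f \<in> Hom A'' X Y" and c: "is_cokernel A'' f c"
    then have XY: "ob j_lsh X \<in> \<C>" "ob j_lsh Y \<in> \<C>"
      by (auto simp: ess_image_eq)
    note cD = A''.is_cokernelD(1)[OF c f]
    have "Cod A (ar j_lsh c) \<in> \<C>"
      using C(1) XY j_lsh.ar_Hom[OF f] J.left_adjoint_is_cokernel[OF f c]
      unfolding ICE_closed_def by blast
    then show "Cod A'' c \<in> ?W"
      using HomD[OF j_lsh.ar_Hom[OF cD]] A''.Hom_Obj[OF cD] by (simp add: ess_image_eq)
  next
    fix X Y Z f g
    assume f: "f \<in> Hom A'' X Y" and g: "g \<in> Hom A'' Y Z" and ex: "short_exact A'' f g"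
      and "X \<in> ?W" "Z \<in> ?W"
    then have XZ: "ob j_lsh X \<in> \<C>" "ob j_lsh Z \<in> \<C>"
      by (auto simp: ess_image_eq)
    note Ff = j_lsh.ar_Hom[OF f]
    \<comment> \<open>The arrow \<open>ar j_lsh f\<close> need not be mono, but \<open>j_us\<close>
      makes it mono again, so its kernel object is killed by \<open>j_us\<close> and lies in
      \<open>\<C>\<close>. With \<open>ar j_lsh g\<close> as cokernel,
      \<open>ICE_closed_target\<close> reaches \<open>ob j_lsh Y\<close>.\<close>
    obtain k where k: "is_kernel A (ar j_lsh f) k"
      using A.ex_kernel[OF HomD(1)[OF Ff]] by blast
    note kD = A.is_kernelD(1)[OF k Ff]
    have "mono_arr A'' (ar j_us (ar j_lsh f))"
      using J.mono_unit_conjugate[OF f] ex by (simp add: short_exact_def)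
    then have "zero_obj A'' (ob j_us (Dom A k))"
      using A''.kernel_of_mono_zero_obj[OF j_us_is_kernel[OF Ff k]] j_us_Dom[OF kD] by simp
    then have "Dom A k \<in> \<C>"
      using A.Hom_Obj[OF kD] by (simp add: zero_obj_j_us_in_C)
    moreover have "is_cokernel A (ar j_lsh f) (ar j_lsh g)"
      using f A''.short_exact_is_cokernel[OF f g ex] by (rule J.left_adjoint_is_cokernel)
    moreover have "Cod A (ar j_lsh g) \<in> \<C>"
      using XZ(2) HomD[OF j_lsh.ar_Hom[OF g]] by simp
    ultimately have "ob j_lsh Y \<in> \<C>"
      using A.ICE_closed_target[OF C(1) Ff k _ XZ(1)] by blast
    then show "Y \<in> ?W"
      using A''.Hom_Obj[OF f] by (simp add: ess_image_eq)
  qed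
qed

text \<open>\<open>\<C>\<close> contains the image of a zero object of \<open>A'\<close>.
  Conversely, the empty subcategory of \<open>A''\<close> has empty preimage, which cannot contain
  the image of \<open>i_ls\<close>; this is why it is left out of the bijection.\<close>

lemma ess_image_nonempty: "ess_image A'' j_us \<C> \<noteq> {}"
proof -
  obtain Z where Z: "zero_obj A' Z"
    using A'.ex_zero_obj by blast
  then have "ob i_ls Z \<in> Obj A"
    by (auto simp: zero_obj_def intro: i_ls.ob_Obj)
  then have "ob i_ls Z \<in> \<C>"
    using C(2) Z A.isomorphic_refl by (auto simp: ess_image_def zero_obj_def)
  then show ?thesis
    using preimage_ess_image by blast
qed

end

end

theorem theorem3p10:
  fixes A' :: "('o1, 'm1) acat" and A :: "('o2, 'm2) acat" and A'' :: "('o3, 'm3) acat"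
    and i_us :: "('o2, 'm2, 'o1, 'm1) ftr" and i_ls :: "('o1, 'm1, 'o2, 'm2) ftr"
    and i_ush :: "('o2, 'm2, 'o1, 'm1) ftr"
    and j_lsh :: "('o3, 'm3, 'o2, 'm2) ftr" and j_us :: "('o2, 'm2, 'o3, 'm3) ftr"
    and j_ls :: "('o3, 'm3, 'o2, 'm2) ftr"
    and \<C>s :: "'o2 set set" and \<W>s :: "'o3 set set"
  assumes "recollement A' A A'' i_us i_ls i_ush j_lsh j_us j_ls"
  defines "\<C>s \<equiv> {\<C>. ICE_closed A \<C> \<and> ess_image A i_ls (Obj A') \<subseteq> \<C> \<and>
                      ess_image A (ftr_comp j_lsh j_us) \<C> \<subseteq> \<C>}"
    and "\<W>s \<equiv> {\<W>. ICE_closed A'' \<W> \<and> \<W> \<noteq> {}}"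
  shows "bij_betw (\<lambda>\<C>. ess_image A'' j_us \<C>) \<C>s \<W>s \<and>
         (\<forall>\<W> \<in> \<W>s. inv_into \<C>s (\<lambda>\<C>. ess_image A'' j_us \<C>) \<W> = {M \<in> Obj A. ob j_us M \<in> \<W>})"
proof -
  interpret recollement A' A A'' i_us i_ls i_ush j_lsh j_us j_ls by fact
  let ?pre = "\<lambda>\<W>. {M \<in> Obj A. ob j_us M \<in> \<W>}"
  have pre: "?pre \<W> \<in> \<C>s" "ess_image A'' j_us (?pre \<W>) = \<W>" if "\<W> \<in> \<W>s" for \<W>
    using that ICE_closed_preimage preimage_contains ess_image_preimage
    by (auto simp: \<C>s_def \<W>s_def ICE_closed_def[of A''])
  have img: "ess_image A'' j_us \<C> \<in> \<W>s" "?pre (ess_image A'' j_us \<C>) = \<C>" if "\<C> \<in> \<C>s" for \<C>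
    using that ICE_closed_ess_image ess_image_nonempty preimage_ess_image
    by (simp_all add: \<C>s_def \<W>s_def)
  have bij: "bij_betw (\<lambda>\<C>. ess_image A'' j_us \<C>) \<C>s \<W>s"
    using pre img by (intro bij_betw_byWitness[where f' = ?pre]) auto
  \<comment> \<open>\<open>inv_into\<close> chooses some member of \<open>\<C>s\<close> over
    \<open>\<W>\<close>; injectivity forces it to be the preimage.\<close>
  moreover have "inv_into \<C>s (\<lambda>\<C>. ess_image A'' j_us \<C>) \<W> = ?pre \<W>" if "\<W> \<in> \<W>s" for \<W>
    using bij_betw_imp_inj_on[OF bij] pre[OF that] by (rule inv_into_f_eq)
  ultimately show ?thesis
    by blast
qed

end
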